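(* Let $G$ be a subgroup of $\mathrm{PL}^+(I)$, the group of orientation-preserving piecewise-linear homeomorphisms of the unit interval $I=[0,1]$. Then the stable commutator length of every element of the commutator subgroup $[G,G]$ is zero.
   Context: A piecewise-linear homeomorphism of $[0,1]$ is one that is linear on each of finitely many subintervals covering $[0,1]$. For a group $G$ and $g\in[G,G]$, the commutator length $\ell'(g)$ is the minimal number of commutators whose product equals $g$, and the stable commutator length is $\ell(g)=\liminf_{n\to\infty}\ell'(g^n)/n$. *)

theory Defs
  imports "HOL-Analysis.Analysis" "HOL-Library.Extended_Real"
begin

definition PLplus :: "(real \<Rightarrow> real) set" where
  "PLplus = {f. (\<exists>h. homeomorphism {0..1} {0..1} f h)
              \<and> mono_on {0..1} f
              \<and> (\<forall>x. x \<notin> {0..1} \<longrightarrow> f x = x)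
              \<and> (\<exists>(a::nat \<Rightarrow> real) k. a 0 = 0 \<and> a k = 1 \<and> (\<forall>i<k. a i < a (Suc i))
                   \<and> (\<forall>i<k. \<exists>m c. \<forall>x\<in>{a i..a (Suc i)}. f x = m * x + c))}"

definition is_subgroup_PL :: "(real \<Rightarrow> real) set \<Rightarrow> bool" where
  "is_subgroup_PL G \<longleftrightarrow> G \<subseteq> PLplus \<and> id \<in> G
     \<and> (\<forall>f\<in>G. \<forall>g\<in>G. f \<circ> g \<in> G) \<and> (\<forall>f\<in>G. inv f \<in> G)"

definition comm :: "(real \<Rightarrow> real) \<Rightarrow> (real \<Rightarrow> real) \<Rightarrow> (real \<Rightarrow> real)" where
  "comm a b = a \<circ> b \<circ> inv a \<circ> inv b"

definition prod_comms :: "(real \<Rightarrow> real) set \<Rightarrow> nat \<Rightarrow> (real \<Rightarrow> real) \<Rightarrow> bool" where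
  "prod_comms G n g \<longleftrightarrow> (\<exists>as bs. (\<forall>i<n. as i \<in> G \<and> bs i \<in> G)
      \<and> g = foldr (\<circ>) (map (\<lambda>i. comm (as i) (bs i)) [0..<n]) id)"

definition commutator_subgroup :: "(real \<Rightarrow> real) set \<Rightarrow> (real \<Rightarrow> real) set" where
  "commutator_subgroup G = {g. \<exists>n. prod_comms G n g}"

definition comm_length :: "(real \<Rightarrow> real) set \<Rightarrow> (real \<Rightarrow> real) \<Rightarrow> nat" where
  "comm_length G g = (LEAST n. prod_comms G n g)"

definition scl :: "(real \<Rightarrow> real) set \<Rightarrow> (real \<Rightarrow> real) \<Rightarrow> ereal" where
  "scl G g = liminf (\<lambda>n. ereal (real (comm_length G (g ^^ n)) / real n))"

end

theory Submission
  imports Defs "HOL-Algebra.Generated_Groups"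
begin

text \<open>If an element \<open>h\<close> displaces a subgroup \<open>K\<close>, in the sense that \<open>K\<close> commutes with all
  its conjugates by positive powers of \<open>h\<close>, then the powers of a product of \<open>m\<close> commutators
  of \<open>K\<close> are products of \<open>m + 1\<close> commutators, so its stable commutator length vanishes.

  A finitely generated subgroup of \<open>PL\<^sup>+(I)\<close> has only finitely many gaps between its common
  fixed points, and near the ends of the gaps a commutator is the identity because linear germs
  commute. On a single gap a compact support can be displaced. One element need not displace the
  supports in all gaps simultaneously, so one adds gaps one at a time: let \<open>P\<close> and
  \<open>R\<close> be the normal subgroups of elements with compact support in the first \<open>k\<close> and the first
  \<open>k + 1\<close> gaps. Displacing the last gap makes the conjugates commute modulo the
  commutators of the whole group that lie in \<open>P\<close>. The latter generate a normal
  subgroup on which the stable commutator length vanishes if it vanishes on \<open>[P, P]\<close>, and such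
  normal subgroups can be factored out.\<close>

section \<open>Commutator lengths in abstract groups\<close>

context group
begin

lemma inv_mult_cancel:
  assumes "x \<in> carrier G" "y \<in> carrier G"
  shows "inv x \<otimes> (x \<otimes> y) = y" "x \<otimes> (inv x \<otimes> y) = y"
  using assms by (simp_all flip: m_assoc)

lemmas group_simps = m_assoc inv_mult_group inv_mult_cancel

lemma commute_iff_commutator:
  assumes "x \<in> carrier G" "y \<in> carrier G"
  shows "x \<otimes> y = y \<otimes> x \<longleftrightarrow> x \<otimes> y \<otimes> inv x \<otimes> inv y = \<one>"
  using assms by (metis inv_mult_group inv_solve_right' m_assoc m_closed one_closed r_one inv_closed l_one)

lemma commute_pow:
  assumes "x \<in> carrier G" "y \<in> carrier G" "x \<otimes> y = y \<otimes> x"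
  shows "x \<otimes> y [^] (n::nat) = y [^] n \<otimes> x"
proof (induction n)
  case (Suc n)
  have "x \<otimes> (y [^] n \<otimes> y) = (y [^] n \<otimes> x) \<otimes> y"
    using Suc assms by (simp flip: m_assoc)
  also have "\<dots> = y [^] n \<otimes> y \<otimes> x"
    using assms by (simp add: m_assoc)
  finally show ?case by simp
qed (use assms in simp)

end

section \<open>Products of a given number of commutators\<close>

primrec pprod :: "('a, 'b) monoid_scheme \<Rightarrow> 'a set \<Rightarrow> nat \<Rightarrow> 'a set" where
  "pprod G S 0 = {\<one>\<^bsub>G\<^esub>}"
| "pprod G S (Suc n) = {s \<otimes>\<^bsub>G\<^esub> x |s x. s \<in> S \<and> x \<in> pprod G S n}"

text \<open>The number of factors is exact, so numbers add under multiplication; membership with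
  index \<open>n\<close> serves as the bound \<open>n\<close> on a commutator length.\<close>

abbreviation cprod :: "('a, 'b) monoid_scheme \<Rightarrow> 'a set \<Rightarrow> nat \<Rightarrow> 'a set" where
  "cprod G H \<equiv> pprod G (derived_set G H)"

lemma pprod_SucI: "s \<in> S \<Longrightarrow> x \<in> pprod G S n \<Longrightarrow> s \<otimes>\<^bsub>G\<^esub> x \<in> pprod G S (Suc n)"
  by auto

context group
begin

lemma pprod_closed: "S \<subseteq> carrier G \<Longrightarrow> x \<in> pprod G S n \<Longrightarrow> x \<in> carrier G"
  by (induction n arbitrary: x) auto

lemma pprod_subset_mono: "S \<subseteq> T \<Longrightarrow> pprod G S n \<subseteq> pprod G T n"
  by (induction n) auto

lemma pprod_mult:
  assumes "S \<subseteq> carrier G" "x \<in> pprod G S m" "y \<in> pprod G S n"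
  shows "x \<otimes> y \<in> pprod G S (m + n)"
  using assms(2)
proof (induction m arbitrary: x)
  case 0
  then show ?case using assms by (simp add: pprod_closed)
next
  case (Suc m)
  then obtain s z where x: "x = s \<otimes> z" "s \<in> S" "z \<in> pprod G S m" by auto
  then have "x \<otimes> y = s \<otimes> (z \<otimes> y)"
    using assms by (simp add: m_assoc pprod_closed subset_iff)
  then show ?case using x Suc.IH by auto
qed

lemma pprod_singleton: "S \<subseteq> carrier G \<Longrightarrow> s \<in> S \<Longrightarrow> s \<in> pprod G S 1"
  by (auto intro!: exI[of _ s])

lemma pprod_pow:
  assumes "S \<subseteq> carrier G" "x \<in> pprod G S m"
  shows "x [^] (k::nat) \<in> pprod G S (m * k)"
proof (induction k)
  case (Suc k)
  then show ?case
    using pprod_mult[OF assms(1) Suc assms(2)] by (simp add: add.commute)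
qed simp

lemma pprod_in_subgroup: "subgroup H G \<Longrightarrow> S \<subseteq> H \<Longrightarrow> x \<in> pprod G S n \<Longrightarrow> x \<in> H"
  by (induction n arbitrary: x) (auto simp: subgroup.one_closed intro!: subgroup.m_closed)

lemma generate_eq_pprod:
  assumes S: "S \<subseteq> carrier G" and inv: "\<And>s. s \<in> S \<Longrightarrow> inv s \<in> S"
  shows "generate G S = (\<Union>n. pprod G S n)"
proof (intro equalityI subsetI)
  fix x assume "x \<in> generate G S"
  then show "x \<in> (\<Union>n. pprod G S n)"
  proof induction
    case one
    show ?case by (auto intro: exI[of _ 0])
  next
    case (incl h)
    then show ?case using pprod_singleton[OF S] by blast
  next
    case (inv h)
    then show ?case using pprod_singleton[OF S] assms(2) by blast
  next
    case (eng h1 h2)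
    then show ?case using pprod_mult[OF S] by blast
  qed
next
  fix x assume "x \<in> (\<Union>n. pprod G S n)"
  then show "x \<in> generate G S"
    using pprod_in_subgroup[OF generate_is_subgroup[OF S], of S] generate.incl[of _ S G] by blast
qed

lemma inv_commutator:
  assumes "a \<in> carrier G" "b \<in> carrier G"
  shows "inv (a \<otimes> b \<otimes> inv a \<otimes> inv b) = b \<otimes> a \<otimes> inv b \<otimes> inv a"
  using assms by (simp add: group_simps)

lemma conj_commutator:
  assumes "g \<in> carrier G" "a \<in> carrier G" "b \<in> carrier G"
  shows "g \<otimes> (a \<otimes> b \<otimes> inv a \<otimes> inv b) \<otimes> inv g =
    (g \<otimes> a \<otimes> inv g) \<otimes> (g \<otimes> b \<otimes> inv g) \<otimes> inv (g \<otimes> a \<otimes> inv g) \<otimes> inv (g \<otimes> b \<otimes> inv g)"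
  using assms by (simp add: group_simps)

lemma derived_set_inv:
  assumes "H \<subseteq> carrier G" "x \<in> derived_set G H" shows "inv x \<in> derived_set G H"
proof -
  obtain a b where "a \<in> H" "b \<in> H" "x = a \<otimes> b \<otimes> inv a \<otimes> inv b" using assms(2) by auto
  then show ?thesis using inv_commutator[of a b] assms(1) by blast
qed

lemma derived_set_conj:
  assumes "H \<lhd> G" "x \<in> derived_set G H" "g \<in> carrier G"
  shows "g \<otimes> x \<otimes> inv g \<in> derived_set G H"
proof -
  have sub: "H \<subseteq> carrier G" using assms(1) normal_imp_subgroup subgroup.subset by blast
  obtain a b where ab: "a \<in> H" "b \<in> H" "x = a \<otimes> b \<otimes> inv a \<otimes> inv b"
    using assms(2) by auto
  have "g \<otimes> a \<otimes> inv g \<in> H" "g \<otimes> b \<otimes> inv g \<in> H"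
    using ab assms normal.inv_op_closed2 by metis+
  then show ?thesis
    using conj_commutator[of g a b] ab sub assms(3) by blast
qed

lemma derived_eq_cprod:
  assumes "H \<subseteq> carrier G" shows "derived G H = (\<Union>n. cprod G H n)"
  unfolding derived_def
  by (rule generate_eq_pprod[OF derived_set_in_carrier[OF assms] derived_set_inv[OF assms]])

lemma cprod_closed: "H \<subseteq> carrier G \<Longrightarrow> x \<in> cprod G H n \<Longrightarrow> x \<in> carrier G"
  by (rule pprod_closed[OF derived_set_in_carrier])

lemma cprod_mult:
  assumes "H \<subseteq> carrier G" "x \<in> cprod G H m" "y \<in> cprod G H n"
  shows "x \<otimes> y \<in> cprod G H (m + n)"
  by (rule pprod_mult[OF derived_set_in_carrier[OF assms(1)] assms(2,3)])

lemma cprod_pow: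
  assumes "H \<subseteq> carrier G" "x \<in> cprod G H m"
  shows "x [^] (k::nat) \<in> cprod G H (m * k)"
  by (rule pprod_pow[OF derived_set_in_carrier[OF assms(1)] assms(2)])

lemma cprod_commutator: "H \<subseteq> carrier G \<Longrightarrow> a \<in> H \<Longrightarrow> b \<in> H \<Longrightarrow> a \<otimes> b \<otimes> inv a \<otimes> inv b \<in> cprod G H 1"
  using pprod_singleton[OF derived_set_in_carrier] by blast

lemma cprod_conj:
  assumes "H \<lhd> G" "x \<in> cprod G H n" "g \<in> carrier G"
  shows "g \<otimes> x \<otimes> inv g \<in> cprod G H n"
  using assms(2)
proof (induction n arbitrary: x)
  case 0
  then show ?case using assms by simp
next
  case (Suc n)
  have sub: "H \<subseteq> carrier G" using assms(1) normal_imp_subgroup subgroup.subset by blast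
  obtain s z where x: "x = s \<otimes> z" "s \<in> derived_set G H" "z \<in> cprod G H n" using Suc by auto
  have c: "s \<in> carrier G" "z \<in> carrier G"
    using x(2) derived_set_in_carrier[OF sub] cprod_closed[OF sub x(3)] by blast+
  have "g \<otimes> x \<otimes> inv g = (g \<otimes> s \<otimes> inv g) \<otimes> (g \<otimes> z \<otimes> inv g)"
    unfolding x(1) using c assms(3) by (simp add: group_simps)
  then show ?case
    using pprod_SucI[OF derived_set_conj[OF assms(1) x(2) assms(3)] Suc.IH[OF x(3)]] by simp
qed

text \<open>Moving one more \<open>y\<close> past \<open>x [^] k\<close> costs one commutator in
  each step of the induction, hence \<open>k\<close> in total.\<close>

lemma mult_pow_cprod:
  assumes "x \<in> carrier G" "y \<in> carrier G"
  shows "\<exists>w \<in> cprod G (carrier G) k. (x \<otimes> y) [^] k = x [^] k \<otimes> y [^] k \<otimes> w"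
proof (induction k)
  case (Suc k)
  then obtain w where w: "w \<in> cprod G (carrier G) k" "(x \<otimes> y) [^] k = x [^] k \<otimes> y [^] k \<otimes> w" by auto
  \<comment> \<open>The choice gives
    \<open>x [^] k \<otimes> y \<otimes> u = y \<otimes> x [^] k\<close> and
    \<open>u \<otimes> y [^] k = y [^] k \<otimes> v\<close>. The double inverses put
    \<open>u\<close> in the shape of a commutator and \<open>v\<close> in that of a
    conjugate.\<close>
  define u where "u = inv y \<otimes> inv (x [^] k) \<otimes> inv (inv y) \<otimes> inv (inv (x [^] k))"
  define v where "v = inv (y [^] k) \<otimes> u \<otimes> inv (inv (y [^] k))"
  have wc: "w \<in> carrier G" using w(1) cprod_closed by blast
  have uc: "u \<in> carrier G" unfolding u_def using assms by simp
  have u1: "u \<in> cprod G (carrier G) 1"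
    unfolding u_def using assms by (intro cprod_commutator) auto
  have v1: "v \<in> cprod G (carrier G) 1"
    unfolding v_def using assms u1 by (intro cprod_conj normal_self) auto
  have "v \<otimes> w \<in> cprod G (carrier G) (Suc k)"
    using cprod_mult[OF _ v1 w(1)] by simp
  moreover have "(x \<otimes> y) [^] Suc k = x [^] Suc k \<otimes> y [^] Suc k \<otimes> (v \<otimes> w)"
    unfolding nat_pow_Suc2[OF m_closed[OF assms]] nat_pow_Suc2[OF assms(1)] nat_pow_Suc2[OF assms(2)] w(2)
    unfolding v_def u_def using assms wc by (simp add: group_simps)
  ultimately show ?case by blast
qed simp

text \<open>A limit-free form of "the stable commutator length is at most \<open>C\<close>". The
  constant \<open>K\<close> absorbs bounded errors, such as the cost of a remainder when an exponent
  is divided. Asking for membership in \<open>cprod\<close> avoids a minimum over a possibly empty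
  set.\<close>

definition cl_rate_le :: "'a \<Rightarrow> real \<Rightarrow> bool" where
  "cl_rate_le x C \<longleftrightarrow> (\<exists>K. \<forall>k::nat. \<exists>n. x [^] k \<in> cprod G (carrier G) n \<and> real n \<le> C * real k + K)"

definition scl_zero :: "'a \<Rightarrow> bool" where
  "scl_zero x \<longleftrightarrow> (\<forall>\<epsilon>>0. cl_rate_le x \<epsilon>)"

lemma cl_rate_le_cprod:
  assumes "x \<in> cprod G (carrier G) m" shows "cl_rate_le x m"
  unfolding cl_rate_le_def
proof (rule exI[of _ 0], intro allI)
  fix k :: nat
  show "\<exists>n. x [^] k \<in> cprod G (carrier G) n \<and> real n \<le> real m * real k + 0"
    using cprod_pow[OF subset_refl assms] by (intro exI[of _ "m * k"]) simp
qed

text \<open>The summand 1 is the one commutator per unit of the exponent from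
  \<open>mult_pow_cprod\<close>. It does no harm: the bound is applied to high powers of an element,
  and \<open>cl_rate_le_root\<close> then divides it by the exponent.\<close>

lemma cl_rate_le_mult:
  assumes "x \<in> carrier G" "y \<in> carrier G" "cl_rate_le x C" "cl_rate_le y D"
  shows "cl_rate_le (x \<otimes> y) (C + D + 1)"
proof -
  obtain K L where
    K: "\<And>k::nat. \<exists>n. x [^] k \<in> cprod G (carrier G) n \<and> real n \<le> C * real k + K" and
    L: "\<And>k::nat. \<exists>n. y [^] k \<in> cprod G (carrier G) n \<and> real n \<le> D * real k + L"
    using assms(3,4) unfolding cl_rate_le_def by blast
  have "\<exists>n. (x \<otimes> y) [^] k \<in> cprod G (carrier G) n \<and> real n \<le> (C + D + 1) * real k + (K + L)" for k :: nat
  proof -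
    obtain m n w where
      m: "x [^] k \<in> cprod G (carrier G) m" "real m \<le> C * real k + K" and
      n: "y [^] k \<in> cprod G (carrier G) n" "real n \<le> D * real k + L" and
      w: "w \<in> cprod G (carrier G) k" "(x \<otimes> y) [^] k = x [^] k \<otimes> y [^] k \<otimes> w"
      using K L mult_pow_cprod[OF assms(1,2)] by meson
    have "(x \<otimes> y) [^] k \<in> cprod G (carrier G) (m + n + k)"
      unfolding w(2) using m n w by (intro cprod_mult) auto
    then show ?thesis
      using m(2) n(2) by (intro exI[of _ "m + n + k"]) (auto simp: algebra_simps)
  qed
  then show ?thesis unfolding cl_rate_le_def by blast
qed

text \<open>Homogeneity of the stable commutator length: divide \<open>k\<close> by
  \<open>n\<close>. The leftover factor \<open>x [^] (k mod n)\<close> costs at most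
  \<open>r * n\<close> commutators, a constant.\<close>

lemma cl_rate_le_root:
  assumes x: "x \<in> cprod G (carrier G) r" and n: "n > 0" and C: "0 \<le> C" "cl_rate_le (x [^] (n::nat)) C"
  shows "cl_rate_le x (C / n)"
proof -
  have xc: "x \<in> carrier G" using x cprod_closed by blast
  obtain K where K: "\<And>k::nat. \<exists>m. (x [^] n) [^] k \<in> cprod G (carrier G) m \<and> real m \<le> C * real k + K"
    using C(2) unfolding cl_rate_le_def by blast
  have "\<exists>m. x [^] k \<in> cprod G (carrier G) m \<and> real m \<le> C / n * real k + (K + r * n)" for k :: nat
  proof -
    obtain m where m: "(x [^] n) [^] (k div n) \<in> cprod G (carrier G) m" "real m \<le> C * real (k div n) + K"
      using K by blast
    have "x [^] k = (x [^] n) [^] (k div n) \<otimes> x [^] (k mod n)"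
      using xc by (simp add: nat_pow_pow nat_pow_mult)
    moreover have "x [^] (k mod n) \<in> cprod G (carrier G) (r * (k mod n))"
      using x by (intro cprod_pow) auto
    ultimately have "x [^] k \<in> cprod G (carrier G) (m + r * (k mod n))"
      using m(1) cprod_mult by auto
    moreover have "real (k div n) \<le> k / n" by (rule of_nat_div_le_of_nat)
    then have "C * real (k div n) \<le> C * (k / n)" using C(1) by (rule mult_left_mono)
    moreover have "real (r * (k mod n)) \<le> r * n"
      using n by (intro of_nat_mono) simp
    ultimately show ?thesis
      using m(2) by (intro exI[of _ "m + r * (k mod n)"]) auto
  qed
  then show ?thesis unfolding cl_rate_le_def by blast
qed

lemma scl_zero_one: "scl_zero \<one>"
  unfolding scl_zero_def cl_rate_le_def
proof (intro allI impI)
  fix \<epsilon> :: real assume "\<epsilon> > 0"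
  then have "\<forall>k::nat. \<one> [^] k \<in> cprod G (carrier G) 0 \<and> real 0 \<le> \<epsilon> * real k + 0"
    by simp
  then show "\<exists>K. \<forall>k::nat. \<exists>n. \<one> [^] k \<in> cprod G (carrier G) n \<and> real n \<le> \<epsilon> * real k + K"
    by blast
qed

end

lemma (in group_hom) cprod_image:
  assumes "K \<subseteq> carrier G" "x \<in> cprod G K n" shows "h x \<in> cprod H (h ` K) n"
  using assms(2)
proof (induction n arbitrary: x)
  case 0
  then show ?case by simp
next
  case (Suc n)
  then obtain a b z where ab: "a \<in> K" "b \<in> K" "z \<in> cprod G K n"
     "x = (a \<otimes> b \<otimes> inv a \<otimes> inv b) \<otimes> z" by auto
  moreover have "a \<in> carrier G" "b \<in> carrier G" "z \<in> carrier G"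
    using ab assms(1) G.cprod_closed by blast+
  ultimately have "h x = (h a \<otimes>\<^bsub>H\<^esub> h b \<otimes>\<^bsub>H\<^esub> inv\<^bsub>H\<^esub> h a \<otimes>\<^bsub>H\<^esub> inv\<^bsub>H\<^esub> h b) \<otimes>\<^bsub>H\<^esub> h z"
    by simp
  then show ?case using ab Suc.IH by auto
qed

text \<open>Lifting the two entries of every commutator keeps the number of commutators, so a bound
  in a quotient comes back to the group up to a factor from the kernel.\<close>

lemma (in group_hom) cprod_lift:
  assumes "y \<in> cprod H (h ` carrier G) n" shows "\<exists>x \<in> cprod G (carrier G) n. h x = y"
  using assms
proof (induction n arbitrary: y)
  case 0
  then show ?case by simp
next
  case (Suc n)
  then obtain a b z where ab: "a \<in> carrier G" "b \<in> carrier G" "z \<in> cprod H (h ` carrier G) n"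
     "y = (h a \<otimes>\<^bsub>H\<^esub> h b \<otimes>\<^bsub>H\<^esub> inv\<^bsub>H\<^esub> h a \<otimes>\<^bsub>H\<^esub> inv\<^bsub>H\<^esub> h b) \<otimes>\<^bsub>H\<^esub> z" by auto
  from Suc.IH[OF ab(3)] obtain x where x: "x \<in> cprod G (carrier G) n" "h x = z" by blast
  have "h ((a \<otimes> b \<otimes> inv a \<otimes> inv b) \<otimes> x) = y"
    using ab x G.cprod_closed[OF _ x(1)] by simp
  moreover have "(a \<otimes> b \<otimes> inv a \<otimes> inv b) \<otimes> x \<in> cprod G (carrier G) (Suc n)"
    using ab x by auto
  ultimately show ?case by blast
qed

text \<open>Every power \<open>x [^] n\<close> is an element of \<open>N\<close> times a product of
  \<open>m\<close> commutators, so its rate is bounded independently of \<open>n\<close>. By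
  homogeneity the rate of \<open>x\<close> is at most that bound divided by \<open>n\<close>, for
  every positive \<open>n\<close>.\<close>

lemma (in group) scl_zero_mod:
  assumes N: "N \<lhd> G" and zero: "\<And>w. w \<in> N \<Longrightarrow> scl_zero w"
    and x: "x \<in> cprod G (carrier G) r"
    and bound: "\<And>n::nat. (N #> x) [^]\<^bsub>G Mod N\<^esub> n \<in> cprod (G Mod N) (carrier (G Mod N)) m"
  shows "scl_zero x"
proof -
  interpret N: normal N G by fact
  interpret \<pi>: group_hom G "G Mod N" "\<lambda>x. N #> x"
    using N.factorgroup_is_group N.r_coset_hom_Mod by (simp add: group_hom_def group_hom_axioms_def)
  have xc: "x \<in> carrier G" using x cprod_closed by blast
  have rate: "cl_rate_le (x [^] n) (m + 2)" for n :: nat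
  proof -
    have "N #> (x [^] n) \<in> cprod (G Mod N) ((\<lambda>x. N #> x) ` carrier G) m"
      using bound[of n] xc \<pi>.hom_nat_pow by (simp add: carrier_FactGroup)
    then obtain y where y: "y \<in> cprod G (carrier G) m" "N #> y = N #> (x [^] n)"
      using \<pi>.cprod_lift by blast
    have yc: "y \<in> carrier G" using y cprod_closed by blast
    have "x [^] n \<in> N #> y"
      unfolding y(2) using xc N.subgroup_axioms by (intro rcos_self) auto
    then obtain w where w: "w \<in> N" "x [^] n = w \<otimes> y"
      unfolding r_coset_def by blast
    have wc: "w \<in> carrier G" using w(1) N.subset by blast
    \<comment> \<open>Rate 1 for \<open>w\<close> is an arbitrary positive choice; the last 1 is the
      defect in \<open>cl_rate_le_mult\<close>.\<close>
    have "cl_rate_le (w \<otimes> y) (1 + m + 1)"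
      using cl_rate_le_mult[OF wc yc _ cl_rate_le_cprod[OF y(1)], of 1] zero[OF w(1)]
      by (simp add: scl_zero_def)
    then show ?thesis using w(2) by (simp add: add.commute)
  qed
  show ?thesis unfolding scl_zero_def
  proof (intro allI impI)
    fix \<epsilon> :: real assume e: "\<epsilon> > 0"
    obtain n :: nat where n: "real n > (m + 2) / \<epsilon>" using reals_Archimedean2 by blast
    have "0 < (m + 2) / \<epsilon>" using e by simp
    with n have "0 < real n" by (rule less_trans[rotated])
    then have n0: "n > 0" by simp
    have "cl_rate_le x ((m + 2) / n)"
      by (intro cl_rate_le_root[OF x n0 _ rate]) simp
    moreover have "(m + 2) / n \<le> \<epsilon>"
      using n e n0 by (simp add: field_simps)
    then have "(m + 2) / n * real k \<le> \<epsilon> * real k" for k :: nat by (intro mult_right_mono) auto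
    ultimately show "cl_rate_le x \<epsilon>"
      unfolding cl_rate_le_def by (meson add_right_mono order_trans)
  qed
qed

section \<open>Displacement\<close>

context group
begin

primrec conj_prod :: "'a \<Rightarrow> 'a \<Rightarrow> nat \<Rightarrow> 'a" where
  "conj_prod h c 0 = \<one>"
| "conj_prod h c (Suc n) = h [^] n \<otimes> c \<otimes> inv (h [^] n) \<otimes> conj_prod h c n"

lemma conj_prod_closed [simp]: "h \<in> carrier G \<Longrightarrow> c \<in> carrier G \<Longrightarrow> conj_prod h c n \<in> carrier G"
  by (induction n) auto

text \<open>Adjacent powers of \<open>h\<close> in consecutive conjugates merge to a single
  \<open>inv h\<close>, and the product telescopes.\<close>

lemma conj_prod_eq:
  assumes "h \<in> carrier G" "c \<in> carrier G"
  shows "conj_prod h c n = h [^] n \<otimes> (inv h \<otimes> c) [^] n"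
proof (induction n)
  case (Suc n)
  then show ?case
    unfolding nat_pow_Suc2[OF m_closed[OF inv_closed[OF assms(1)] assms(2)]]
    using assms by (simp add: group_simps)
qed simp

text \<open>The definition splits off the leftmost factor; here the rightmost one, \<open>c\<close>
  itself, is split off, which exposes a conjugate by \<open>h\<close> of the shorter
  product.\<close>

lemma conj_prod_Suc:
  assumes "h \<in> carrier G" "c \<in> carrier G"
  shows "conj_prod h c (Suc n) = h \<otimes> conj_prod h c n \<otimes> inv h \<otimes> c"
  unfolding conj_prod_eq[OF assms] nat_pow_Suc2[OF assms(1)]
  using assms by (simp add: m_assoc)

lemma commute_mult:
  assumes "x \<in> carrier G" "y \<in> carrier G" "z \<in> carrier G" "x \<otimes> y = y \<otimes> x" "x \<otimes> z = z \<otimes> x"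
  shows "x \<otimes> (y \<otimes> z) = (y \<otimes> z) \<otimes> x"
  using assms by (metis m_assoc)

lemma commute_conj_prod:
  assumes c: "c \<in> carrier G" "d \<in> carrier G" "h \<in> carrier G"
    and comm: "\<And>i. i < n \<Longrightarrow> c \<otimes> (h [^] i \<otimes> d \<otimes> inv (h [^] i)) = (h [^] i \<otimes> d \<otimes> inv (h [^] i)) \<otimes> c"
  shows "c \<otimes> conj_prod h d n = conj_prod h d n \<otimes> c"
  using comm
proof (induction n)
  case (Suc n)
  then show ?case
    using c commute_mult[of c "h [^] n \<otimes> d \<otimes> inv (h [^] n)" "conj_prod h d n"] by simp
qed (use c in simp)

text \<open>The commutator is \<open>y \<otimes> (h \<otimes> y \<otimes> inv h)\<inverse>\<close> for the product \<open>y\<close> of the powers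
  \<open>c\<^sub>i\<close> to the exponent \<open>n - 1 - i\<close> of the conjugates \<open>c\<^sub>i\<close> of \<open>c\<close> by \<open>h [^] i\<close>.\<close>

lemma pow_eq_commutator_mult_conj_prod:
  assumes c: "c \<in> carrier G" "h \<in> carrier G"
    and comm: "\<And>i::nat. c \<otimes> (h [^] i \<otimes> c \<otimes> inv (h [^] i)) = (h [^] i \<otimes> c \<otimes> inv (h [^] i)) \<otimes> c"
  shows "\<exists>y \<in> carrier G. c [^] n = y \<otimes> h \<otimes> inv y \<otimes> inv h \<otimes> conj_prod h c n"
proof (induction n)
  case 0
  then show ?case using c by (intro bexI[of _ \<one>]) auto
next
  case (Suc n)
  then obtain y where y: "y \<in> carrier G" "c [^] n = y \<otimes> h \<otimes> inv y \<otimes> inv h \<otimes> conj_prod h c n" by blast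
  define p where "p = conj_prod h c n"
  define q where "q = y \<otimes> h \<otimes> inv y \<otimes> inv h"
  have pc: "p \<in> carrier G" "q \<in> carrier G" using c y by (simp_all add: p_def q_def)
  \<comment> \<open>\<open>p\<close> commutes with \<open>c [^] n\<close>, which equals
    \<open>q \<otimes> p\<close>; cancelling shows that \<open>p\<close> and \<open>q\<close>
    commute.\<close>
  have "p \<otimes> c [^] n = c [^] n \<otimes> p"
    using commute_pow[OF pc(1) c(1)] commute_conj_prod[OF c(1,1,2) comm] by (simp add: p_def)
  then have pq: "p \<otimes> q = c [^] n"
    using y(2) pc c(1) unfolding p_def[symmetric] q_def[symmetric]
    by (metis m_assoc m_closed right_cancel)
  have "c [^] Suc n = p \<otimes> q \<otimes> c" by (simp add: pq)
  \<comment> \<open>Inserting the trivial word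
    \<open>inv p \<otimes> inv h \<otimes> h \<otimes> p\<close> before the last
    \<open>inv h\<close> of \<open>q\<close> makes \<open>p \<otimes> y\<close> the new
    witness.\<close>
  also have "\<dots> = (p \<otimes> y) \<otimes> h \<otimes> inv (p \<otimes> y) \<otimes> inv h \<otimes> (h \<otimes> p \<otimes> inv h \<otimes> c)"
    using pc y c by (simp add: q_def group_simps)
  also have "h \<otimes> p \<otimes> inv h \<otimes> c = conj_prod h c (Suc n)"
    unfolding p_def conj_prod_Suc[OF c(2,1)] ..
  finally show ?case using pc y by blast
qed

text \<open>With \<open>b_i\<close> the conjugate of \<open>b\<close> by \<open>a [^] i\<close>, the
  conjugate of the commutator by \<open>a [^] i\<close> is the quotient of \<open>b_(i+1)\<close> by
  \<open>b_i\<close>. The product telescopes to a single commutator.\<close>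

lemma conj_prod_commutator:
  assumes "a \<in> carrier G" "b \<in> carrier G"
  shows "conj_prod a (a \<otimes> b \<otimes> inv a \<otimes> inv b) n = a [^] n \<otimes> b \<otimes> inv (a [^] n) \<otimes> inv b"
proof (induction n)
  case (Suc n)
  then show ?case
    unfolding conj_prod_Suc[OF assms(1) m_closed[OF m_closed[OF m_closed[OF assms] inv_closed[OF assms(1)]] inv_closed[OF assms(2)]]]
      nat_pow_Suc2[OF assms(1)]
    using assms by (simp add: group_simps)
qed (use assms in simp)

text \<open>The factors can be reordered because the conjugate of \<open>y\<close> by
  \<open>h [^] n\<close> commutes with that of \<open>x\<close> by \<open>h [^] i\<close> for
  \<open>i < n\<close>: conjugating back by \<open>h [^] i\<close> reduces this to
  \<open>comm\<close> with exponent \<open>n - i\<close>, which is at least 1.\<close>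

lemma conj_prod_mult:
  assumes K: "subgroup K G" and h: "h \<in> carrier G"
    and comm: "\<And>a b i. a \<in> K \<Longrightarrow> b \<in> K \<Longrightarrow> i \<ge> 1 \<Longrightarrow>
       a \<otimes> (h [^] (i::nat) \<otimes> b \<otimes> inv (h [^] i)) = (h [^] i \<otimes> b \<otimes> inv (h [^] i)) \<otimes> a"
    and x: "x \<in> K" and y: "y \<in> K"
  shows "conj_prod h (x \<otimes> y) n = conj_prod h x n \<otimes> conj_prod h y n"
proof (induction n)
  case (Suc n)
  have xc: "x \<in> carrier G" "y \<in> carrier G" using x y K subgroup.mem_carrier by metis+
  define k where "k = h [^] n"
  have kc: "k \<in> carrier G" using h by (simp add: k_def)
  define X where "X = conj_prod h x n"
  define Y where "Y = conj_prod h y n"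
  have XY: "X \<in> carrier G" "Y \<in> carrier G" using xc h by (simp_all add: X_def Y_def)
  have "(k \<otimes> y \<otimes> inv k) \<otimes> X = X \<otimes> (k \<otimes> y \<otimes> inv k)"
    unfolding X_def
  proof (rule commute_conj_prod)
    fix i assume i: "i < n"
    define p where "p = h [^] i"
    define q where "q = h [^] (n - i)"
    have pq: "p \<in> carrier G" "q \<in> carrier G" "k = p \<otimes> q"
      using h i by (simp_all add: p_def q_def k_def nat_pow_mult)
    have "x \<otimes> (q \<otimes> y \<otimes> inv q) = (q \<otimes> y \<otimes> inv q) \<otimes> x"
      unfolding q_def using comm[OF x y, of "n - i"] i by simp
    then have "p \<otimes> (x \<otimes> (q \<otimes> y \<otimes> inv q)) \<otimes> inv p = p \<otimes> ((q \<otimes> y \<otimes> inv q) \<otimes> x) \<otimes> inv p"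
      by simp
    then show "k \<otimes> y \<otimes> inv k \<otimes> (h [^] i \<otimes> x \<otimes> inv (h [^] i)) = h [^] i \<otimes> x \<otimes> inv (h [^] i) \<otimes> (k \<otimes> y \<otimes> inv k)"
      unfolding p_def[symmetric] pq(3) using pq(1,2) xc by (simp add: group_simps)
  qed (use xc kc h in auto)
  then have eq: "k \<otimes> y \<otimes> inv k \<otimes> (X \<otimes> Y) = X \<otimes> ((k \<otimes> y \<otimes> inv k) \<otimes> Y)"
    using xc kc XY by (metis m_assoc m_closed inv_closed)
  have "conj_prod h (x \<otimes> y) (Suc n) = (k \<otimes> x \<otimes> inv k) \<otimes> (k \<otimes> y \<otimes> inv k \<otimes> (X \<otimes> Y))"
    using Suc xc kc XY by (simp add: k_def[symmetric] X_def[symmetric] Y_def[symmetric] group_simps)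
  also have "\<dots> = ((k \<otimes> x \<otimes> inv k) \<otimes> X) \<otimes> ((k \<otimes> y \<otimes> inv k) \<otimes> Y)"
    unfolding eq using xc kc XY by (simp add: m_assoc)
  finally show ?case by (simp add: k_def X_def Y_def)
qed simp

text \<open>On a subgroup that is displaced by \<open>h\<close>, the map \<open>x \<mapsto> conj_prod h x n\<close> is a homomorphism.\<close>

lemma pow_in_cprod_of_displacement:
  assumes K: "subgroup K G" and h: "h \<in> carrier G"
    and comm: "\<And>a b i. a \<in> K \<Longrightarrow> b \<in> K \<Longrightarrow> i \<ge> 1 \<Longrightarrow>
       a \<otimes> (h [^] (i::nat) \<otimes> b \<otimes> inv (h [^] i)) = (h [^] i \<otimes> b \<otimes> inv (h [^] i)) \<otimes> a"
    and x: "x \<in> cprod G K m"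
  shows "x [^] (n::nat) \<in> cprod G (carrier G) (Suc m)"
proof -
  have sub: "K \<subseteq> carrier G" using K subgroup.subset by blast
  have xc: "x \<in> carrier G" using cprod_closed[OF sub x] .
  have xK: "x \<in> K" by (rule pprod_in_subgroup[OF K derived_set_incl[OF subset_refl K] x])
  let ?D = "\<lambda>x. conj_prod h x n"
  \<comment> \<open>\<open>K\<close> becomes a group of its own, as the map is multiplicative only
    there.\<close>
  have hom: "group_hom (G\<lparr>carrier := K\<rparr>) G ?D"
    using conj_prod_mult[OF K h comm] sub h subgroup_imp_group[OF K]
    by (auto simp: group_hom_def group_hom_axioms_def hom_def subset_iff)
  have K': "cprod (G\<lparr>carrier := K\<rparr>) K m = cprod G K m"
  proof -
    have ds: "derived_set (G\<lparr>carrier := K\<rparr>) K = derived_set G K"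
      by (rule derived_set_consistent[OF subset_refl K])
    have "pprod (G\<lparr>carrier := K\<rparr>) S j = pprod G S j" for S j by (induction j) auto
    then show ?thesis unfolding ds .
  qed
  have "?D x \<in> cprod G (?D ` K) m"
    using group_hom.cprod_image[OF hom, of K x m] x unfolding K' by simp
  moreover have "?D ` K \<subseteq> carrier G" using h sub by auto
  ultimately have Dx: "?D x \<in> cprod G (carrier G) m"
    using pprod_subset_mono[OF mono_derived_set] by blast
  \<comment> \<open>\<open>comm\<close> covers only \<open>i \<ge> 1\<close>, since \<open>K\<close>
    may be nonabelian; for \<open>i = 0\<close> the element \<open>x\<close> merely has to commute
    with itself.\<close>
  have "x \<otimes> (h [^] i \<otimes> x \<otimes> inv (h [^] i)) = (h [^] i \<otimes> x \<otimes> inv (h [^] i)) \<otimes> x" for i :: nat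
    using comm[OF xK xK, of i] xc by (cases i) auto
  from pow_eq_commutator_mult_conj_prod[OF xc h this] obtain y where
    y: "y \<in> carrier G" "x [^] n = y \<otimes> h \<otimes> inv y \<otimes> inv h \<otimes> ?D x" by blast
  show ?thesis
    unfolding y(2) using cprod_mult[OF subset_refl cprod_commutator[OF subset_refl y(1) h] Dx] by simp
qed

text \<open>A commutator \<open>c\<close> of \<open>a\<close> and \<open>b\<close> that lies in
  \<open>P\<close> commutes with its conjugates by powers of \<open>a\<close>. So
  \<open>c [^] n\<close> is one commutator times \<open>conj_prod a c n\<close>, which is again a
  commutator by \<open>conj_prod_commutator\<close>. This gives two commutators per factor, and
  powers distribute over products in the abelian \<open>P\<close>.\<close>

lemma pow_in_cprod_of_abelian:
  assumes P: "P \<lhd> G" and comm: "\<And>a b. a \<in> P \<Longrightarrow> b \<in> P \<Longrightarrow> a \<otimes> b = b \<otimes> a"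
    and x: "x \<in> pprod G (derived_set G (carrier G) \<inter> P) m"
  shows "x [^] (n::nat) \<in> cprod G (carrier G) (2 * m)"
  using x
proof (induction m arbitrary: x)
  case 0
  then show ?case by simp
next
  case (Suc m)
  have sub: "P \<subseteq> carrier G" using P normal_imp_subgroup subgroup.subset by blast
  obtain c z where cz: "c \<in> derived_set G (carrier G)" "c \<in> P"
    "z \<in> pprod G (derived_set G (carrier G) \<inter> P) m" "x = c \<otimes> z"
    using Suc.prems by auto
  obtain a b where ab: "a \<in> carrier G" "b \<in> carrier G" "c = a \<otimes> b \<otimes> inv a \<otimes> inv b"
    using cz(1) by blast
  have cc: "c \<in> carrier G" using cz(2) sub by blast
  have zP: "z \<in> P"
    by (rule pprod_in_subgroup[OF normal_imp_subgroup[OF P] _ cz(3)]) blast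
  then have zc: "z \<in> carrier G" using sub by blast
  have "a [^] i \<otimes> c \<otimes> inv (a [^] i) \<in> P" for i :: nat
    using normal.inv_op_closed2[OF P] ab(1) cz(2) nat_pow_closed by blast
  then have "c \<otimes> (a [^] i \<otimes> c \<otimes> inv (a [^] i)) = (a [^] i \<otimes> c \<otimes> inv (a [^] i)) \<otimes> c" for i :: nat
    using comm[OF cz(2)] by blast
  from pow_eq_commutator_mult_conj_prod[OF cc ab(1) this] obtain y where
    y: "y \<in> carrier G" "c [^] n = y \<otimes> a \<otimes> inv y \<otimes> inv a \<otimes> conj_prod a c n" by blast
  have "conj_prod a c n \<in> cprod G (carrier G) 1"
    unfolding ab(3) conj_prod_commutator[OF ab(1,2)] using ab by (intro cprod_commutator) auto
  then have "c [^] n \<in> cprod G (carrier G) (1 + 1)"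
    unfolding y(2) by (intro cprod_mult cprod_commutator y ab subset_refl)
  then have "c [^] n \<otimes> z [^] n \<in> cprod G (carrier G) ((1 + 1) + 2 * m)"
    by (intro cprod_mult Suc.IH cz subset_refl)
  moreover have "x [^] n = c [^] n \<otimes> z [^] n"
    unfolding cz(4) by (rule pow_mult_distrib[OF comm[OF cz(2) zP] cc zc])
  ultimately show ?case by simp
qed

section \<open>Vanishing of stable commutator length modulo a normal subgroup\<close>

lemma Mod_group_hom:
  assumes "N \<lhd> G" shows "group_hom G (G Mod N) (\<lambda>x. N #> x)"
  using normal.factorgroup_is_group[OF assms] normal.r_coset_hom_Mod[OF assms]
  by (simp add: group_hom_def group_hom_axioms_def)

lemma Mod_commute:
  assumes N: "N \<lhd> G" and ab: "a \<in> carrier G" "b \<in> carrier G" "a \<otimes> b \<otimes> inv a \<otimes> inv b \<in> N"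
  shows "(N #> a) \<otimes>\<^bsub>G Mod N\<^esub> (N #> b) = (N #> b) \<otimes>\<^bsub>G Mod N\<^esub> (N #> a)"
proof -
  interpret \<pi>: group_hom G "G Mod N" "\<lambda>x. N #> x" using Mod_group_hom[OF N] .
  have "N #> (a \<otimes> b \<otimes> inv a \<otimes> inv b) = \<one>\<^bsub>G Mod N\<^esub>"
    using coset_join2[OF _ normal_imp_subgroup[OF N] ab(3)] ab(1,2) by simp
  then have "(N #> a) \<otimes>\<^bsub>G Mod N\<^esub> (N #> b) \<otimes>\<^bsub>G Mod N\<^esub> inv\<^bsub>G Mod N\<^esub> (N #> a) \<otimes>\<^bsub>G Mod N\<^esub> inv\<^bsub>G Mod N\<^esub> (N #> b) = \<one>\<^bsub>G Mod N\<^esub>"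
    using ab(1,2) by (simp only: \<pi>.hom_mult \<pi>.hom_inv m_closed inv_closed)
  then show ?thesis
    using \<pi>.H.commute_iff_commutator[OF \<pi>.hom_closed[OF ab(1)] \<pi>.hom_closed[OF ab(2)]] by blast
qed

text \<open>Modulo the derived subgroup of \<open>P\<close> the image of \<open>P\<close> is
  abelian, so \<open>pow_in_cprod_of_abelian\<close> bounds all powers by the same number of
  commutators, and \<open>scl_zero_mod\<close> applies.\<close>

lemma scl_zero_commutators_in:
  assumes P: "P \<lhd> G" and zero: "\<And>w. w \<in> derived G P \<Longrightarrow> scl_zero w"
    and x: "x \<in> generate G (derived_set G (carrier G) \<inter> P)"
  shows "scl_zero x"
proof -
  let ?N = "derived G P"
  let ?S = "derived_set G (carrier G) \<inter> P"
  have subP: "subgroup P G" using P by (rule normal_imp_subgroup)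
  have Pc: "P \<subseteq> carrier G" using subP by (rule subgroup.subset)
  have N: "?N \<lhd> G" by (rule derived_is_normal[OF P])
  interpret \<pi>: group_hom G "G Mod ?N" "\<lambda>x. ?N #> x" by (rule Mod_group_hom[OF N])
  have "generate G ?S = (\<Union>n. pprod G ?S n)"
    using derived_set_inv[OF subset_refl] subgroup.m_inv_closed[OF subP] Pc
    by (intro generate_eq_pprod) blast+
  then obtain m where m: "x \<in> pprod G ?S m" using x by blast
  have sub: "?S \<subseteq> derived_set G (carrier G)" by blast
  have xc: "x \<in> cprod G (carrier G) m" using pprod_subset_mono[OF sub] m by blast
  let ?\<pi> = "\<lambda>x. ?N #> x"
  have \<pi>P: "?\<pi> ` P \<lhd> G Mod ?N"
  proof (rule \<pi>.H.normal_invI)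
    show "subgroup (?\<pi> ` P) (G Mod ?N)" by (rule \<pi>.subgroup_img_is_subgroup[OF subP])
  next
    fix u v assume "u \<in> ?\<pi> ` P" "v \<in> carrier (G Mod ?N)"
    then obtain p g where pg: "p \<in> P" "g \<in> carrier G" "u = ?\<pi> p" "v = ?\<pi> g"
      by (auto simp: carrier_FactGroup)
    then have "v \<otimes>\<^bsub>G Mod ?N\<^esub> u \<otimes>\<^bsub>G Mod ?N\<^esub> inv\<^bsub>G Mod ?N\<^esub> v = ?\<pi> (g \<otimes> p \<otimes> inv g)"
      using Pc by (simp only: subsetD[OF Pc pg(1)] \<pi>.hom_mult \<pi>.hom_inv m_closed inv_closed)
    moreover have "g \<otimes> p \<otimes> inv g \<in> P" using normal.inv_op_closed2[OF P pg(2,1)] .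
    ultimately show "v \<otimes>\<^bsub>G Mod ?N\<^esub> u \<otimes>\<^bsub>G Mod ?N\<^esub> inv\<^bsub>G Mod ?N\<^esub> v \<in> ?\<pi> ` P" by blast
  qed
  have img: "?\<pi> y \<in> pprod (G Mod ?N) (derived_set (G Mod ?N) (carrier (G Mod ?N)) \<inter> ?\<pi> ` P) k"
    if "y \<in> pprod G ?S k" for y k
    using that
  proof (induction k arbitrary: y)
    case 0
    then show ?case using \<pi>.hom_one by simp
  next
    case (Suc k)
    then obtain a b z where ab: "a \<in> carrier G" "b \<in> carrier G" "a \<otimes> b \<otimes> inv a \<otimes> inv b \<in> P"
      "z \<in> pprod G ?S k" "y = (a \<otimes> b \<otimes> inv a \<otimes> inv b) \<otimes> z" by auto
    have zc: "z \<in> carrier G"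
      by (rule pprod_closed[OF _ ab(4)]) (use Pc in blast)
    have hc: "?\<pi> (a \<otimes> b \<otimes> inv a \<otimes> inv b) =
        ?\<pi> a \<otimes>\<^bsub>G Mod ?N\<^esub> ?\<pi> b \<otimes>\<^bsub>G Mod ?N\<^esub> inv\<^bsub>G Mod ?N\<^esub> ?\<pi> a \<otimes>\<^bsub>G Mod ?N\<^esub> inv\<^bsub>G Mod ?N\<^esub> ?\<pi> b"
      using ab(1,2) by (simp only: \<pi>.hom_mult \<pi>.hom_inv m_closed inv_closed)
    have cin: "?\<pi> (a \<otimes> b \<otimes> inv a \<otimes> inv b) \<in> derived_set (G Mod ?N) (carrier (G Mod ?N)) \<inter> ?\<pi> ` P"
      using hc ab(3) \<pi>.hom_closed[OF ab(1)] \<pi>.hom_closed[OF ab(2)] by blast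
    have "?\<pi> y = ?\<pi> (a \<otimes> b \<otimes> inv a \<otimes> inv b) \<otimes>\<^bsub>G Mod ?N\<^esub> ?\<pi> z"
      unfolding ab(5) using \<pi>.hom_mult ab(1,2) zc by simp
    then show ?case using pprod_SucI[OF cin Suc.IH[OF ab(4)]] by simp
  qed
  have comm: "u \<otimes>\<^bsub>G Mod ?N\<^esub> v = v \<otimes>\<^bsub>G Mod ?N\<^esub> u" if uv: "u \<in> ?\<pi> ` P" "v \<in> ?\<pi> ` P" for u v
  proof -
    obtain p q where pq: "p \<in> P" "q \<in> P" "u = ?\<pi> p" "v = ?\<pi> q" using uv by blast
    have "p \<otimes> q \<otimes> inv p \<otimes> inv q \<in> ?N"
      unfolding derived_def using pq(1,2) by (intro generate.incl) blast
    then show ?thesis unfolding pq(3,4) using pq Pc by (intro Mod_commute[OF N]) auto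
  qed
  show ?thesis
    by (rule scl_zero_mod[OF N zero xc \<pi>.H.pow_in_cprod_of_abelian[OF \<pi>P comm img[OF m]]])
qed

text \<open>The commutators in \<open>displ\<close> lie in \<open>P\<close> and are commutators of
  the group, hence lie in the normal subgroup \<open>?N\<close>. In the quotient by
  \<open>?N\<close>, the image of \<open>K\<close> is truly displaced by that of \<open>h\<close>.
  Factoring out \<open>P\<close> would not do: its elements need not be products of commutators. On
  \<open>?N\<close> the length vanishes by \<open>scl_zero_commutators_in\<close>.\<close>

lemma scl_zero_displacement:
  assumes P: "P \<lhd> G" and zero: "\<And>w. w \<in> derived G P \<Longrightarrow> scl_zero w"
    and R: "R \<subseteq> carrier G"
    and displ: "\<And>x m. x \<in> cprod G R m \<Longrightarrow> \<exists>K h. subgroup K G \<and> x \<in> cprod G K m \<and> h \<in> carrier G \<and>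
       (\<forall>a\<in>K. \<forall>b\<in>K. \<forall>i\<ge>1. let b' = h [^] (i::nat) \<otimes> b \<otimes> inv (h [^] i) in a \<otimes> b' \<otimes> inv a \<otimes> inv b' \<in> P)"
    and x: "x \<in> derived G R"
  shows "scl_zero x"
proof -
  let ?S = "derived_set G (carrier G) \<inter> P"
  let ?N = "generate G ?S"
  have Pc: "P \<subseteq> carrier G" using P normal_imp_subgroup subgroup.subset by blast
  have N: "?N \<lhd> G"
  proof (rule normal_generateI)
    show "?S \<subseteq> carrier G" using Pc by blast
  next
    fix c g assume c: "c \<in> ?S" and g: "g \<in> carrier G"
    show "g \<otimes> c \<otimes> inv g \<in> ?S"
      using derived_set_conj[OF normal_self IntD1[OF c] g] normal.inv_op_closed2[OF P g IntD2[OF c]]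
      by (rule IntI)
  qed
  interpret \<pi>: group_hom G "G Mod ?N" "\<lambda>x. ?N #> x" by (rule Mod_group_hom[OF N])
  let ?\<pi> = "\<lambda>x. ?N #> x"
  obtain m where m: "x \<in> cprod G R m" using x derived_eq_cprod[OF R] by blast
  then have xc: "x \<in> cprod G (carrier G) m" by (rule subsetD[OF pprod_subset_mono[OF mono_derived_set[OF R]]])
  obtain K h where K: "subgroup K G" "x \<in> cprod G K m" "h \<in> carrier G" and
    disj': "\<forall>a\<in>K. \<forall>b\<in>K. \<forall>i\<ge>1. let b' = h [^] (i::nat) \<otimes> b \<otimes> inv (h [^] i) in a \<otimes> b' \<otimes> inv a \<otimes> inv b' \<in> P"
    using displ[OF m] by (elim exE conjE) (rule that)
  have disj: "\<And>a b i. a \<in> K \<Longrightarrow> b \<in> K \<Longrightarrow> (i::nat) \<ge> 1 \<Longrightarrow>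
      a \<otimes> (h [^] i \<otimes> b \<otimes> inv (h [^] i)) \<otimes> inv a \<otimes> inv (h [^] i \<otimes> b \<otimes> inv (h [^] i)) \<in> P"
    using disj' unfolding Let_def by simp
  have Kc: "K \<subseteq> carrier G" using K(1) by (rule subgroup.subset)
  have comm: "u \<otimes>\<^bsub>G Mod ?N\<^esub> (?\<pi> h [^]\<^bsub>G Mod ?N\<^esub> i \<otimes>\<^bsub>G Mod ?N\<^esub> v \<otimes>\<^bsub>G Mod ?N\<^esub> inv\<^bsub>G Mod ?N\<^esub> (?\<pi> h [^]\<^bsub>G Mod ?N\<^esub> i))
     = (?\<pi> h [^]\<^bsub>G Mod ?N\<^esub> i \<otimes>\<^bsub>G Mod ?N\<^esub> v \<otimes>\<^bsub>G Mod ?N\<^esub> inv\<^bsub>G Mod ?N\<^esub> (?\<pi> h [^]\<^bsub>G Mod ?N\<^esub> i)) \<otimes>\<^bsub>G Mod ?N\<^esub> u"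
    if uv: "u \<in> ?\<pi> ` K" "v \<in> ?\<pi> ` K" "i \<ge> 1" for u v and i :: nat
  proof -
    obtain a b where ab: "a \<in> K" "b \<in> K" "u = ?\<pi> a" "v = ?\<pi> b" using uv by blast
    have abc: "a \<in> carrier G" "b \<in> carrier G" using ab Kc by auto
    let ?b = "h [^] i \<otimes> b \<otimes> inv (h [^] i)"
    have bc: "?b \<in> carrier G" using abc K(3) by simp
    have "a \<otimes> ?b \<otimes> inv a \<otimes> inv ?b \<in> ?N"
      by (rule generate.incl, rule IntI[OF _ disj[OF ab(1,2) uv(3)]]) (use abc(1) bc in blast)
    then have "u \<otimes>\<^bsub>G Mod ?N\<^esub> ?\<pi> ?b = ?\<pi> ?b \<otimes>\<^bsub>G Mod ?N\<^esub> u"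
      unfolding ab(3) by (rule Mod_commute[OF N abc(1) bc])
    moreover have "?\<pi> ?b = ?\<pi> h [^]\<^bsub>G Mod ?N\<^esub> i \<otimes>\<^bsub>G Mod ?N\<^esub> v \<otimes>\<^bsub>G Mod ?N\<^esub> inv\<^bsub>G Mod ?N\<^esub> (?\<pi> h [^]\<^bsub>G Mod ?N\<^esub> i)"
      using abc K(3) ab(4)
      by (simp only: \<pi>.hom_mult \<pi>.hom_inv \<pi>.hom_nat_pow m_closed inv_closed nat_pow_closed)
    ultimately show ?thesis by simp
  qed
  have "?\<pi> x \<in> cprod (G Mod ?N) (?\<pi> ` K) m" by (rule \<pi>.cprod_image[OF Kc K(2)])
  from \<pi>.H.pow_in_cprod_of_displacement[OF \<pi>.subgroup_img_is_subgroup[OF K(1)] \<pi>.hom_closed[OF K(3)] comm this]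
  show ?thesis
    by (intro scl_zero_mod[OF N scl_zero_commutators_in[OF P zero] xc, of "Suc m"]) auto
qed

end

section \<open>Piecewise linear homeomorphisms\<close>

lemma PLplus_increasing:
  assumes "f \<in> PLplus" shows "strict_mono f" "surj f"
proof -
  from assms obtain h where h: "homeomorphism {0..1} {0..1} f h"
    and mono: "mono_on {0..1} f" and out: "\<And>x. x \<notin> {0..1} \<Longrightarrow> f x = x"
    unfolding PLplus_def by blast
  have img: "f ` {0..1} = {0..1}" using h by (rule homeomorphism_image1)
  have inj: "inj_on f {0..1}"
    using h unfolding homeomorphism_def by (metis inj_on_inverseI)
  show "strict_mono f"
  proof (rule strict_monoI)
    fix x y :: real assume xy: "x < y"
    consider "x \<in> {0..1}" "y \<in> {0..1}" | "x \<in> {0..1}" "y > 1" | "x < 0" "y \<in> {0..1}"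
      | "x \<notin> {0..1}" "y \<notin> {0..1}" using xy by fastforce
    then show "f x < f y"
    proof cases
      case 1
      then have "f x \<le> f y" using mono xy by (auto simp: mono_on_def)
      moreover have "f x \<noteq> f y" using inj_onD[OF inj] 1 xy by (metis less_irrefl)
      ultimately show ?thesis by simp
    next
      case 2
      then have "f x \<in> {0..1}" using img by blast
      then show ?thesis using out[of y] 2 by auto
    next
      case 3
      then have "f y \<in> {0..1}" using img by blast
      then show ?thesis using out[of x] 3 by auto
    next
      case 4
      then show ?thesis using out xy by simp
    qed
  qed
  show "surj f"
    unfolding surj_def
  proof
    fix y show "\<exists>x. y = f x"
    proof (cases "y \<in> {0..1}")
      case True
      then show ?thesis using img by (metis imageE)
    next
      case False
      then show ?thesis using out[of y] by metis
    qed
  qed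
qed

lemma strict_mono_surj_continuous:
  fixes f :: "real \<Rightarrow> real"
  assumes "strict_mono f" "surj f" shows "isCont f x"
proof -
  have "continuous_on UNIV f"
    using assms by (intro continuous_onI_mono) (auto simp: strict_mono_less_eq)
  then show ?thesis by (simp add: continuous_on_eq_continuous_at)
qed

text \<open>Beyond the definition this covers the endpoints: the preimage of 0 lies in the unit
  interval, so monotonicity forces \<open>f 0 \<le> 0\<close>; dually at 1.\<close>

lemma PLplus_fixes_outside:
  assumes "f \<in> PLplus" "x \<le> 0 \<or> 1 \<le> x" shows "f x = x"
proof -
  have out: "\<And>x. x \<notin> {0..1} \<Longrightarrow> f x = x" using assms(1) unfolding PLplus_def by blast
  note mono = PLplus_increasing(1)[OF assms(1)]
  have surj: "\<exists>y. f y = z" for z using PLplus_increasing(2)[OF assms(1)] by (metis surjD)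
  have in01: "f z \<in> {0..1}" if "z \<in> {0..1}" for z
    using out[of "f z"] strict_mono_eq[OF mono] that by metis
  obtain y where y: "f y = 0" using surj by blast
  then have "y \<in> {0..1}" using out[of y] by (metis atLeastAtMost_iff order_refl zero_le_one)
  then have "f 0 \<le> 0" using y strict_mono_less_eq[OF mono, of 0 y] by auto
  obtain z where z: "f z = 1" using surj by blast
  then have "z \<in> {0..1}" using out[of z] by (metis atLeastAtMost_iff order_refl zero_le_one)
  then have "f 1 \<ge> 1" using z strict_mono_less_eq[OF mono, of z 1] by auto
  with \<open>f 0 \<le> 0\<close> show ?thesis using in01[of 0] in01[of 1] out[of x] assms(2) by fastforce
qed

section \<open>One-sided germs at fixed points\<close>

lemma increasing_filterlim_at_right:
  fixes f :: "real \<Rightarrow> real"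
  assumes "strict_mono f" "surj f" "f p = p"
  shows "filterlim f (at_right p) (at_right p)"
  unfolding filterlim_at
proof
  show "\<forall>\<^sub>F x in at_right p. f x \<in> {p<..} \<and> f x \<noteq> p"
    unfolding eventually_at_filter
  proof (intro always_eventually allI impI)
    fix x assume "x \<in> {p<..}"
    then show "f x \<in> {p<..} \<and> f x \<noteq> p" using strict_monoD[OF assms(1), of p x] assms(3) by auto
  qed
  show "(f \<longlongrightarrow> p) (at_right p)"
    using strict_mono_surj_continuous[OF assms(1,2), of p] assms(3)
    by (metis isCont_def at_le tendsto_mono top_greatest)
qed

lemma increasing_filterlim_at_left:
  fixes f :: "real \<Rightarrow> real"
  assumes "strict_mono f" "surj f" "f p = p"
  shows "filterlim f (at_left p) (at_left p)"
  unfolding filterlim_at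
proof
  show "\<forall>\<^sub>F x in at_left p. f x \<in> {..<p} \<and> f x \<noteq> p"
    unfolding eventually_at_filter
  proof (intro always_eventually allI impI)
    fix x assume "x \<in> {..<p}"
    then show "f x \<in> {..<p} \<and> f x \<noteq> p" using strict_monoD[OF assms(1), of x p] assms(3) by auto
  qed
  show "(f \<longlongrightarrow> p) (at_left p)"
    using strict_mono_surj_continuous[OF assms(1,2), of p] assms(3)
    by (metis isCont_def at_le tendsto_mono top_greatest)
qed

text \<open>The two half-open versions provide a piece reaching to the right and to the left of
  \<open>p\<close>. It ends at the first partition point beyond \<open>p\<close>.\<close>

lemma partition_piece:
  fixes a :: "nat \<Rightarrow> real"
  assumes "a 0 = 0" "a k = 1"
  shows "0 \<le> p \<Longrightarrow> p < 1 \<Longrightarrow> \<exists>i<k. a i \<le> p \<and> p < a (Suc i)"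
    and "0 < p \<Longrightarrow> p \<le> 1 \<Longrightarrow> \<exists>i<k. a i < p \<and> p \<le> a (Suc i)"
proof -
  assume p: "0 \<le> p" "p < 1"
  define j where "j = (LEAST j. p < a j)"
  have j: "p < a j" "j \<le> k"
    unfolding j_def using p assms by (auto intro: LeastI[of "\<lambda>j. p < a j" k] Least_le)
  then obtain i where i: "j = Suc i" using p assms by (cases j) auto
  then have "\<not> p < a i" unfolding j_def using not_less_Least[of i "\<lambda>j. p < a j"] by auto
  then show "\<exists>i<k. a i \<le> p \<and> p < a (Suc i)" using i j by (intro exI[of _ i]) auto
next
  assume p: "0 < p" "p \<le> 1"
  define j where "j = (LEAST j. p \<le> a j)"
  have j: "p \<le> a j" "j \<le> k"
    unfolding j_def using p assms by (auto intro: LeastI[of "\<lambda>j. p \<le> a j" k] Least_le)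
  then obtain i where i: "j = Suc i" using p assms by (cases j) auto
  then have "\<not> p \<le> a i" unfolding j_def using not_less_Least[of i "\<lambda>j. p \<le> a j"] by auto
  then show "\<exists>i<k. a i < p \<and> p \<le> a (Suc i)" using i j by (intro exI[of _ i]) auto
qed

lemma PLplus_germs:
  assumes "f \<in> PLplus" "f p = p"
  shows "\<exists>m. \<forall>\<^sub>F x in at_right p. f x = p + m * (x - p)"
    and "\<exists>m. \<forall>\<^sub>F x in at_left p. f x = p + m * (x - p)"
proof -
  from assms obtain a :: "nat \<Rightarrow> real" and k where a: "a 0 = 0" "a k = 1" "\<And>i. i < k \<Longrightarrow> a i < a (Suc i)"
    and lin: "\<And>i. i < k \<Longrightarrow> \<exists>m c. \<forall>x\<in>{a i..a (Suc i)}. f x = m * x + c"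
    and out: "\<And>x. x \<notin> {0..1} \<Longrightarrow> f x = x"
    unfolding PLplus_def by blast
  have lin': "\<exists>m. \<forall>x\<in>{a i..a (Suc i)}. f x = p + m * (x - p)" if i: "i < k" "a i \<le> p" "p \<le> a (Suc i)" for i
  proof -
    obtain m c where m: "\<And>x. x \<in> {a i..a (Suc i)} \<Longrightarrow> f x = m * x + c" using lin[OF i(1)] by blast
    have "p = m * p + c" using m[of p] i assms by simp
    then have "f x = p + m * (x - p)" if "x \<in> {a i..a (Suc i)}" for x
      using m[OF that] by (simp add: algebra_simps)
    then show ?thesis by blast
  qed
  show "\<exists>m. \<forall>\<^sub>F x in at_right p. f x = p + m * (x - p)"
  proof (cases "0 \<le> p \<and> p < 1")
    case True
    then obtain i where i: "i < k" "a i \<le> p" "p < a (Suc i)" using partition_piece(1)[OF a(1,2)] by blast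
    then obtain m where m: "\<And>x. x \<in> {a i..a (Suc i)} \<Longrightarrow> f x = p + m * (x - p)"
      using lin'[of i] by fastforce
    have "f x = p + m * (x - p)" if "p < x" "x < a (Suc i)" for x using m[of x] that i by simp
    then have "\<forall>\<^sub>F x in at_right p. f x = p + m * (x - p)"
      using i(3) unfolding eventually_at_right_field by blast
    then show ?thesis by blast
  next
    case False
    \<comment> \<open>Here \<open>f\<close> is the identity on the right of \<open>p\<close>, with
      slope 1; \<open>b\<close> bounds a one-sided neighbourhood that misses the unit
      interval.\<close>
    define b where "b = (if p < 0 then 0 else p + 1)"
    have "f x = p + 1 * (x - p)" if "p < x" "x < b" for x
      using out[of x] that False by (auto simp: b_def split: if_splits)
    moreover have "p < b" by (simp add: b_def)
    ultimately show ?thesis unfolding eventually_at_right_field by blast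
  qed
  show "\<exists>m. \<forall>\<^sub>F x in at_left p. f x = p + m * (x - p)"
  proof (cases "0 < p \<and> p \<le> 1")
    case True
    then obtain i where i: "i < k" "a i < p" "p \<le> a (Suc i)" using partition_piece(2)[OF a(1,2)] by blast
    then obtain m where m: "\<And>x. x \<in> {a i..a (Suc i)} \<Longrightarrow> f x = p + m * (x - p)"
      using lin'[of i] by fastforce
    have "f x = p + m * (x - p)" if "a i < x" "x < p" for x using m[of x] that i by simp
    then have "\<forall>\<^sub>F x in at_left p. f x = p + m * (x - p)"
      using i(2) unfolding eventually_at_left_field by blast
    then show ?thesis by blast
  next
    case False
    define b where "b = (if p \<le> 0 then p - 1 else 1)"
    have "f x = p + 1 * (x - p)" if "b < x" "x < p" for x
      using out[of x] that False by (auto simp: b_def split: if_splits)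
    moreover have "b < p" using False by (auto simp: b_def)
    ultimately show ?thesis unfolding eventually_at_left_field by blast
  qed
qed

text \<open>Both composites are multiplication by \<open>m * n\<close> about \<open>p\<close>; the
  \<open>filterlim\<close> hypotheses keep the inner values where the outer map is linear.\<close>

lemma linear_germs_commute:
  fixes f g :: "real \<Rightarrow> real"
  assumes f: "\<forall>\<^sub>F x in F. f x = p + m * (x - p)" "filterlim f F F"
    and g: "\<forall>\<^sub>F x in F. g x = p + n * (x - p)" "filterlim g F F"
  shows "\<forall>\<^sub>F x in F. f (g x) = g (f x)"
proof -
  have "\<forall>\<^sub>F x in F. f (g x) = p + m * (g x - p)" using f(1) g(2) by (rule eventually_compose_filterlim)
  moreover have "\<forall>\<^sub>F x in F. g (f x) = p + n * (f x - p)" using g(1) f(2) by (rule eventually_compose_filterlim)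
  ultimately show ?thesis using f(1) g(1) by eventually_elim simp
qed

lemma eventually_at_split_nhds:
  fixes p :: real
  assumes "P p" "eventually P (at_left p)" "eventually P (at_right p)"
  shows "eventually P (nhds p)"
  using assms by (simp add: eventually_nhds_conv_at eventually_at_split)

lemma PLplus_commute_near_fixpoint:
  assumes "f \<in> PLplus" "g \<in> PLplus" "f p = p" "g p = p"
  shows "\<forall>\<^sub>F x in nhds p. f (g x) = g (f x)"
proof (rule eventually_at_split_nhds)
  note lim = increasing_filterlim_at_left[OF PLplus_increasing] increasing_filterlim_at_right[OF PLplus_increasing]
  show "\<forall>\<^sub>F x in at_left p. f (g x) = g (f x)"
    using PLplus_germs(2) assms linear_germs_commute lim(1) by meson
  show "\<forall>\<^sub>F x in at_right p. f (g x) = g (f x)"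
    using PLplus_germs(1) assms linear_germs_commute lim(2) by meson
qed (use assms in simp)

text \<open>The solution set is the whole interval or has at most one point.\<close>

lemma finite_frontier_linear_fixpoints:
  fixes a b m c :: real
  shows "finite (frontier {x \<in> {a..b}. m * x + c = x})"
proof -
  have fin: "finite S \<Longrightarrow> finite (frontier S)" for S :: "real set"
    by (metis closure_closed finite_imp_closed finite_subset frontier_def Diff_subset)
  show ?thesis
  proof (cases "m = 1 \<and> c = 0")
    case True
    then have "{x \<in> {a..b}. m * x + c = x} = cbox a b" by auto
    moreover have "frontier (cbox a b) \<subseteq> {a, b}" by (auto simp: frontier_def interior_atLeastAtMost_real)
    ultimately show ?thesis by (metis finite.emptyI finite.insertI finite_subset)
  next
    case False
    have "{x \<in> {a..b}. m * x + c = x} \<subseteq> {c / (1 - m)}"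
    proof
      fix x assume "x \<in> {x \<in> {a..b}. m * x + c = x}"
      then have "c = (1 - m) * x" by (auto simp: algebra_simps)
      moreover from this have "1 - m \<noteq> 0" using False by auto
      ultimately show "x \<in> {c / (1 - m)}" by simp
    qed
    then show ?thesis by (meson fin finite.emptyI finite.insertI finite_subset)
  qed
qed

text \<open>The fixed point set can contain intervals, so finiteness is claimed for its frontier
  only. The set is a finite union of fixed point sets of linear pieces and two rays.\<close>

lemma finite_frontier_fixpoints:
  assumes "f \<in> PLplus" shows "finite (frontier {x. f x = x})"
proof -
  from assms obtain a :: "nat \<Rightarrow> real" and k where a: "a 0 = 0" "a k = 1" "\<And>i. i < k \<Longrightarrow> a i < a (Suc i)"
    and lin: "\<And>i. i < k \<Longrightarrow> \<exists>m c. \<forall>x\<in>{a i..a (Suc i)}. f x = m * x + c"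
    and out: "\<And>x. x \<notin> {0..1} \<Longrightarrow> f x = x"
    unfolding PLplus_def by blast
  have f01: "f 0 = 0" "f 1 = 1" using PLplus_fixes_outside[OF assms] by auto
  let ?P = "\<lambda>i. {x \<in> {a i..a (Suc i)}. f x = x}"
  let ?A = "\<Union>(?P ` {..<k})"
  have finP: "finite (frontier (?P i))" if i: "i < k" for i
  proof -
    obtain m c where m: "\<And>x. x \<in> {a i..a (Suc i)} \<Longrightarrow> f x = m * x + c" using lin[OF i] by blast
    then have "?P i = {x \<in> {a i..a (Suc i)}. m * x + c = x}" by auto
    then show ?thesis using finite_frontier_linear_fixpoints by simp
  qed
  have finA: "finite (frontier ?A)"
    using finP by (intro finite_subset[OF frontier_Union_subset]) auto
  have "{x. f x = x} = {..0} \<union> (?A \<union> {1..})"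
  proof (intro equalityI subsetI)
    fix x assume x: "x \<in> {x. f x = x}"
    show "x \<in> {..0} \<union> (?A \<union> {1..})"
    proof (cases "0 < x \<and> x < 1")
      case True
      then obtain i where "i < k" "a i \<le> x" "x < a (Suc i)" using partition_piece(1)[OF a(1,2), of x] by auto
      then show ?thesis using x by auto
    qed auto
  next
    fix x assume "x \<in> {..0} \<union> (?A \<union> {1..})"
    then show "x \<in> {x. f x = x}"
      using out[of x] f01 by (cases "x < 0 \<or> x > 1") force+
  qed
  moreover have "frontier ({..0} \<union> (?A \<union> {1..})) \<subseteq> frontier {..0} \<union> (frontier ?A \<union> frontier {1..})"
    using frontier_Un_subset[of "{..0::real}" "?A \<union> {1..}"] frontier_Un_subset[of ?A "{1::real..}"]
    by blast
  moreover have "finite (frontier {..0::real})" "finite (frontier {1::real..})"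
    by (rule finite_subset[of _ "{0}"], auto simp: frontier_def)
      (rule finite_subset[of _ "{1}"], auto simp: frontier_def)
  with finA have "finite (frontier {..0} \<union> (frontier ?A \<union> frontier {1..}))" by simp
  ultimately show ?thesis by (simp only: finite_subset)
qed

section \<open>Groups acting on the gaps of a finite set of fixed points\<close>

text \<open>By injectivity a map that moves a point also moves its image, so the other map fixes
  both. The statement is relative to an invariant set because it is applied on a single gap.\<close>

lemma commute_if_disjoint_supports:
  assumes "inj f" "inj g" "f ` X \<subseteq> X" "g ` X \<subseteq> X"
    and disj: "\<And>x. x \<in> X \<Longrightarrow> f x = x \<or> g x = x" and "x \<in> X"
  shows "f (g x) = g (f x)"
proof (cases "f x = x")
  case True
  then show ?thesis
    using disj[of "g x"] assms by (metis image_subset_iff injD)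
next
  case False
  then show ?thesis
    using disj[of x] disj[of "f x"] assms by (metis image_subset_iff injD)
qed

definition comp_group :: "('a \<Rightarrow> 'a) set \<Rightarrow> ('a \<Rightarrow> 'a) monoid" where
  "comp_group \<Gamma> = \<lparr>carrier = \<Gamma>, monoid.mult = (\<circ>), one = id\<rparr>"

lemma comp_group_simps [simp]:
  "carrier (comp_group \<Gamma>) = \<Gamma>" "f \<otimes>\<^bsub>comp_group \<Gamma>\<^esub> g = f \<circ> g" "\<one>\<^bsub>comp_group \<Gamma>\<^esub> = id"
  by (simp_all add: comp_group_def)

text \<open>Not naming the next point of \<open>C\<close> makes the formula meaningful for the
  largest point too, where it gives a ray.\<close>

definition gap :: "real set \<Rightarrow> real \<Rightarrow> real set" where
  "gap C c = {x. c < x \<and> (\<forall>d\<in>C. d \<le> c \<or> x < d)}"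

text \<open>What the displacement argument needs from piecewise linear maps: finitely many gaps,
  each either fixed pointwise or bounded without common fixed points, and commuting germs at the
  ends. Linearity is not mentioned any more.\<close>

locale gap_group =
  fixes \<Gamma> :: "(real \<Rightarrow> real) set" and C :: "real set"
  assumes grp: "group (comp_group \<Gamma>)"
    and mono: "g \<in> \<Gamma> \<Longrightarrow> strict_mono g"
    and finite_C: "finite C"
    and fix_C: "g \<in> \<Gamma> \<Longrightarrow> c \<in> C \<Longrightarrow> g c = c"
    and fix_outside: "g \<in> \<Gamma> \<Longrightarrow> (\<And>c. c \<in> C \<Longrightarrow> x < c) \<Longrightarrow> g x = x"
    and gap_cases: "c \<in> C \<Longrightarrow> (\<forall>x\<in>gap C c. \<forall>g\<in>\<Gamma>. g x = x) \<or>
       (\<exists>d\<in>C. c < d \<and> gap C c = {c<..<d} \<and> (\<forall>x\<in>gap C c. \<exists>g\<in>\<Gamma>. g x \<noteq> x))"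
    and commute_near: "f \<in> \<Gamma> \<Longrightarrow> g \<in> \<Gamma> \<Longrightarrow> c \<in> C \<Longrightarrow> \<forall>\<^sub>F x in nhds c. f (g x) = g (f x)"
begin

sublocale G: group "comp_group \<Gamma>" by (rule grp)

abbreviation inverse_map ("_\<^sup>-" [1000] 1000) where "inverse_map g \<equiv> m_inv (comp_group \<Gamma>) g"

lemma closed: "id \<in> \<Gamma>" "f \<in> \<Gamma> \<Longrightarrow> g \<in> \<Gamma> \<Longrightarrow> f \<circ> g \<in> \<Gamma>" "f \<in> \<Gamma> \<Longrightarrow> f\<^sup>- \<in> \<Gamma>"
  using G.one_closed G.m_closed[of f g] G.inv_closed[of f] by simp_all

lemma inverse_app [simp]: assumes "f \<in> \<Gamma>" shows "f (f\<^sup>- x) = x" "f\<^sup>- (f x) = x"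
proof -
  have "f \<circ> f\<^sup>- = id" "f\<^sup>- \<circ> f = id" using G.r_inv[of f] G.l_inv[of f] assms by simp_all
  then show "f (f\<^sup>- x) = x" "f\<^sup>- (f x) = x" by (metis comp_apply id_apply)+
qed

lemma map_less: "f \<in> \<Gamma> \<Longrightarrow> f x < f y \<longleftrightarrow> x < y" and map_le: "f \<in> \<Gamma> \<Longrightarrow> f x \<le> f y \<longleftrightarrow> x \<le> y"
  by (simp_all add: mono strict_mono_less strict_mono_less_eq)

lemma map_inj: "f \<in> \<Gamma> \<Longrightarrow> inj f"
  by (rule inj_on_inverseI[of _ "f\<^sup>-"]) simp

lemma map_isCont: "f \<in> \<Gamma> \<Longrightarrow> isCont f x"
  by (rule strict_mono_surj_continuous[OF mono surjI[of _ "f\<^sup>-"]]) simp_all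

lemma filterlim_nhds: "f \<in> \<Gamma> \<Longrightarrow> c \<in> C \<Longrightarrow> filterlim f (nhds c) (nhds c)"
  using map_isCont[of f c] fix_C[of f c] unfolding isCont_def tendsto_at_iff_tendsto_nhds by simp

lemma map_gap: "f \<in> \<Gamma> \<Longrightarrow> c \<in> C \<Longrightarrow> x \<in> gap C c \<Longrightarrow> f x \<in> gap C c"
  using fix_C[of f] map_less[of f] unfolding gap_def by (smt (verit) mem_Collect_eq)

text \<open>Being the identity near \<open>C\<close> expresses compact support inside the gaps. The
  sets for \<open>T\<close> and \<open>insert c T\<close> are the \<open>P\<close> and
  \<open>R\<close> of the overview.\<close>

definition supp_gaps :: "real set \<Rightarrow> (real \<Rightarrow> real) set" where
  "supp_gaps T = {g \<in> \<Gamma>. (\<forall>c\<in>C. \<forall>\<^sub>F x in nhds c. g x = x) \<and> (\<forall>c\<in>C - T. \<forall>x\<in>gap C c. g x = x)}"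

lemma inverse_fixes: "g \<in> \<Gamma> \<Longrightarrow> g x = x \<Longrightarrow> g\<^sup>- x = x"
  by (metis inverse_app(2))

lemma supp_gaps_subgroup: "subgroup (supp_gaps T) (comp_group \<Gamma>)"
proof (rule G.subgroupI)
  show "supp_gaps T \<subseteq> carrier (comp_group \<Gamma>)" by (auto simp: supp_gaps_def)
  have "id \<in> supp_gaps T" using closed(1) by (simp add: supp_gaps_def)
  then show "supp_gaps T \<noteq> {}" by blast
next
  fix g assume g: "g \<in> supp_gaps T"
  then have "\<forall>\<^sub>F x in nhds c. g\<^sup>- x = x" if "c \<in> C" for c
    using that by (auto simp: supp_gaps_def inverse_fixes elim!: eventually_mono)
  with g show "g\<^sup>- \<in> supp_gaps T" by (auto simp: supp_gaps_def inverse_fixes closed)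
next
  fix f g assume fg: "f \<in> supp_gaps T" "g \<in> supp_gaps T"
  have "\<forall>\<^sub>F x in nhds c. f (g x) = x" if c: "c \<in> C" for c
  proof -
    have "\<forall>\<^sub>F x in nhds c. f x = x" "\<forall>\<^sub>F x in nhds c. g x = x" using fg c by (auto simp: supp_gaps_def)
    then show ?thesis by eventually_elim simp
  qed
  with fg show "f \<otimes>\<^bsub>comp_group \<Gamma>\<^esub> g \<in> supp_gaps T" by (auto simp: supp_gaps_def closed)
qed

lemma supp_gaps_normal: "supp_gaps T \<lhd> comp_group \<Gamma>"
proof (rule G.normal_invI[OF supp_gaps_subgroup])
  fix g h assume gh: "g \<in> supp_gaps T" "h \<in> carrier (comp_group \<Gamma>)"
  then have h: "h \<in> \<Gamma>" "h\<^sup>- \<in> \<Gamma>" and g: "g \<in> \<Gamma>" by (auto simp: closed supp_gaps_def)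
  have "\<forall>\<^sub>F x in nhds c. h (g (h\<^sup>- x)) = x" if c: "c \<in> C" for c
  proof -
    have "\<forall>\<^sub>F x in nhds c. g x = x" using gh c by (auto simp: supp_gaps_def)
    then have "\<forall>\<^sub>F x in nhds c. g (h\<^sup>- x) = h\<^sup>- x"
      using filterlim_nhds[OF h(2) c] by (rule eventually_compose_filterlim)
    then show ?thesis by eventually_elim (simp add: h)
  qed
  moreover have "h (g (h\<^sup>- x)) = x" if "c \<in> C - T" "x \<in> gap C c" for c x
  proof -
    have "h\<^sup>- x \<in> gap C c" using map_gap h(2) that by blast
    then have "g (h\<^sup>- x) = h\<^sup>- x" using gh that by (auto simp: supp_gaps_def)
    then show ?thesis by (simp add: h)
  qed
  ultimately show "h \<otimes>\<^bsub>comp_group \<Gamma>\<^esub> g \<otimes>\<^bsub>comp_group \<Gamma>\<^esub> h\<^sup>- \<in> supp_gaps T"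
    using g h by (auto simp: supp_gaps_def closed)
qed

lemma supp_gaps_empty: "supp_gaps {} = {id}"
proof (intro equalityI subsetI)
  fix g assume g: "g \<in> supp_gaps {}"
  have "g x = x" for x
  proof (cases "x \<in> C \<or> (\<forall>c\<in>C. x < c)")
    case True
    then show ?thesis using g fix_C fix_outside by (auto simp: supp_gaps_def)
  next
    case False
    \<comment> \<open>The left end of the gap that contains \<open>x\<close>.\<close>
    define c where "c = Max {c \<in> C. c < x}"
    have ne: "{c \<in> C. c < x} \<noteq> {}" using False by fastforce
    have fin: "finite {c \<in> C. c < x}" using finite_C by simp
    have "c \<in> C" "c < x" using Max_in[OF fin ne] by (auto simp: c_def)
    moreover have "d \<le> c \<or> x < d" if "d \<in> C" for d
      using Max_ge[OF fin, of d] that False by (cases "d < x") (auto simp: c_def)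
    ultimately show ?thesis using g by (auto simp: supp_gaps_def gap_def)
  qed
  then show "g \<in> {id}" by auto
qed (use closed in \<open>simp add: supp_gaps_def\<close>)

lemma supp_gaps_insertD:
  "g \<in> supp_gaps (insert c T) \<Longrightarrow> (\<And>x. x \<in> gap C c \<Longrightarrow> g x = x) \<Longrightarrow> g \<in> supp_gaps T"
  by (auto simp: supp_gaps_def)

text \<open>Otherwise the orbit of \<open>p\<close> stays below \<open>q\<close>, and its supremum
  is a common fixed point strictly between \<open>c\<close> and \<open>d\<close>.\<close>

lemma exists_map_beyond:
  assumes cd: "c \<in> C" "d \<in> C" and nofix: "\<And>x. c < x \<Longrightarrow> x < d \<Longrightarrow> \<exists>g\<in>\<Gamma>. g x \<noteq> x"
    and pq: "c < p" "q < d"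
  shows "\<exists>h\<in>\<Gamma>. q < h p"
proof (rule ccontr)
  assume "\<not> (\<exists>h\<in>\<Gamma>. q < h p)"
  then have le: "h p \<le> q" if "h \<in> \<Gamma>" for h using that by force
  define s where "s = Sup ((\<lambda>h. h p) ` \<Gamma>)"
  have bdd: "bdd_above ((\<lambda>h. h p) ` \<Gamma>)" using le by (intro bdd_aboveI[of _ q]) auto
  have ne: "(\<lambda>h. h p) ` \<Gamma> \<noteq> {}" using closed(1) by blast
  have ge: "h p \<le> s" if "h \<in> \<Gamma>" for h unfolding s_def using that bdd by (intro cSup_upper) auto
  have "p \<le> s" using ge[OF closed(1)] by simp
  moreover have "s \<le> q" unfolding s_def using le ne by (intro cSup_least) auto
  \<comment> \<open>If \<open>h\<close> moved the supremum up, then \<open>h\<close> would carry an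
    orbit point close below it to an orbit point above it.\<close>
  moreover have sle: "h s \<le> s" if h: "h \<in> \<Gamma>" for h
  proof (rule ccontr)
    assume "\<not> h s \<le> s"
    then have "h\<^sup>- s < s" using map_less[OF closed(3)[OF h], of s "h s"] h by simp
    then obtain k where k: "k \<in> \<Gamma>" "h\<^sup>- s < k p"
      unfolding s_def using less_cSupD[OF ne] by fastforce
    then have "s < h (k p)" using map_less[OF h, of "h\<^sup>- s" "k p"] h by simp
    then show False using ge[OF closed(2)[OF h k(1)]] by simp
  qed
  moreover have "h s = s" if h: "h \<in> \<Gamma>" for h
    using sle[OF h] sle[OF closed(3)[OF h]] map_le[OF h, of "h\<^sup>- s" s] h by simp
  ultimately show False using nofix[of s] pq by force
qed

text \<open>Only the gap at \<open>c\<close> is confined to an interval; in the other gaps of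
  \<open>T\<close> nothing has to be displaced.\<close>

definition supp_within :: "real set \<Rightarrow> real \<Rightarrow> real \<Rightarrow> real \<Rightarrow> (real \<Rightarrow> real) set" where
  "supp_within T c p q = {g \<in> supp_gaps T. \<forall>x\<in>gap C c. x \<notin> {p..q} \<longrightarrow> g x = x}"

lemma supp_within_subgroup: "subgroup (supp_within T c p q) (comp_group \<Gamma>)"
proof (rule G.subgroupI)
  show "supp_within T c p q \<subseteq> carrier (comp_group \<Gamma>)" by (auto simp: supp_within_def supp_gaps_def)
  have "id \<in> supp_gaps T" using subgroup.one_closed[OF supp_gaps_subgroup] by simp
  then show "supp_within T c p q \<noteq> {}" unfolding supp_within_def by fastforce
next
  fix g assume g: "g \<in> supp_within T c p q"
  then have "g \<in> \<Gamma>" by (auto simp: supp_within_def supp_gaps_def)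
  moreover have "g\<^sup>- \<in> supp_gaps T"
    using g subgroup.m_inv_closed[OF supp_gaps_subgroup] by (auto simp: supp_within_def)
  ultimately show "g\<^sup>- \<in> supp_within T c p q" using g by (auto simp: supp_within_def inverse_fixes)
next
  fix f g assume fg: "f \<in> supp_within T c p q" "g \<in> supp_within T c p q"
  then have "f \<circ> g \<in> supp_gaps T"
    using subgroup.m_closed[OF supp_gaps_subgroup, of f T g] by (auto simp: supp_within_def)
  then show "f \<otimes>\<^bsub>comp_group \<Gamma>\<^esub> g \<in> supp_within T c p q" using fg by (auto simp: supp_within_def)
qed

lemma supp_within_mono: "p' \<le> p \<Longrightarrow> q \<le> q' \<Longrightarrow> supp_within T c p q \<subseteq> supp_within T c p' q'"
  by (auto simp: supp_within_def)

lemma supp_within_exists: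
  assumes g: "g \<in> supp_gaps T" and cd: "c \<in> C" "d \<in> C" "c < d" "gap C c = {c<..<d}"
  shows "\<exists>p q. c < p \<and> p \<le> q \<and> q < d \<and> g \<in> supp_within T c p q"
proof -
  obtain e where e: "e > 0" "\<And>x. dist x c < e \<Longrightarrow> g x = x"
    using g cd(1) unfolding supp_gaps_def eventually_nhds_metric by blast
  obtain e' where e': "e' > 0" "\<And>x. dist x d < e' \<Longrightarrow> g x = x"
    using g cd(2) unfolding supp_gaps_def eventually_nhds_metric by blast
  \<comment> \<open>The midpoint keeps \<open>p \<le> q\<close> and both inside the gap when the
    radii are large.\<close>
  define p where "p = min (c + e) ((c + d) / 2)"
  define q where "q = max (d - e') ((c + d) / 2)"
  have "g x = x" if "c < x" "x < d" "x \<notin> {p..q}" for x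
    using e(2)[of x] e'(2)[of x] that by (auto simp: p_def q_def dist_real_def)
  then have "g \<in> supp_within T c p q" using g cd(4) by (auto simp: supp_within_def)
  moreover have "c < p" "p \<le> q" "q < d" using e(1) e'(1) cd(3) by (auto simp: p_def q_def)
  ultimately show ?thesis by blast
qed

text \<open>A product of commutators has finitely many entries, so one compact interval serves for
  all of them.\<close>

lemma cprod_supp_within_exists:
  assumes cd: "c \<in> C" "d \<in> C" "c < d" "gap C c = {c<..<d}"
    and x: "x \<in> cprod (comp_group \<Gamma>) (supp_gaps T) m"
  shows "\<exists>p q. c < p \<and> p \<le> q \<and> q < d \<and> x \<in> cprod (comp_group \<Gamma>) (supp_within T c p q) m"
  using x
proof (induction m arbitrary: x)
  case 0
  obtain p where "c < p" "p < d" using dense[OF cd(3)] by blast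
  with 0 show ?case by (auto simp: id_def)
next
  case (Suc m)
  let ?c = "\<lambda>a b. a \<otimes>\<^bsub>comp_group \<Gamma>\<^esub> b \<otimes>\<^bsub>comp_group \<Gamma>\<^esub> a\<^sup>- \<otimes>\<^bsub>comp_group \<Gamma>\<^esub> b\<^sup>-"
  obtain s z where sz: "s \<in> derived_set (comp_group \<Gamma>) (supp_gaps T)"
    "z \<in> cprod (comp_group \<Gamma>) (supp_gaps T) m" "x = s \<otimes>\<^bsub>comp_group \<Gamma>\<^esub> z"
    using Suc.prems unfolding pprod.simps by blast
  obtain a b where ab: "a \<in> supp_gaps T" "b \<in> supp_gaps T" "s = ?c a b"
    using sz(1) by blast
  obtain p1 q1 where 1: "c < p1" "p1 \<le> q1" "q1 < d" "a \<in> supp_within T c p1 q1"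
    using supp_within_exists[OF ab(1) cd] by blast
  obtain p2 q2 where 2: "c < p2" "p2 \<le> q2" "q2 < d" "b \<in> supp_within T c p2 q2"
    using supp_within_exists[OF ab(2) cd] by blast
  obtain p3 q3 where 3: "c < p3" "p3 \<le> q3" "q3 < d" "z \<in> cprod (comp_group \<Gamma>) (supp_within T c p3 q3) m"
    using Suc.IH[OF sz(2)] by blast
  define p where "p = min p1 (min p2 p3)"
  define q where "q = max q1 (max q2 q3)"
  let ?K = "supp_within T c p q"
  have "supp_within T c p1 q1 \<subseteq> ?K" "supp_within T c p2 q2 \<subseteq> ?K"
    by (rule supp_within_mono; auto simp: p_def q_def)+
  then have "a \<in> ?K" "b \<in> ?K" using 1(4) 2(4) by auto
  then have s: "s \<in> derived_set (comp_group \<Gamma>) ?K" unfolding ab(3) by blast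
  have "supp_within T c p3 q3 \<subseteq> ?K" by (rule supp_within_mono) (auto simp: p_def q_def)
  then have z: "z \<in> cprod (comp_group \<Gamma>) ?K m"
    by (rule subsetD[OF G.pprod_subset_mono[OF G.mono_derived_set] 3(4)])
  have "x \<in> cprod (comp_group \<Gamma>) ?K (Suc m)"
    unfolding sz(3) by (rule pprod_SucI[OF s z])
  moreover have "c < p" "p \<le> q" "q < d" using 1 2 3 by (auto simp: p_def q_def)
  ultimately show ?case by blast
qed

text \<open>The iterates of \<open>p\<close> increase, so a single \<open>h\<close> displaces the
  interval by all its positive powers.\<close>

lemma map_pow_beyond:
  assumes "h \<in> \<Gamma>" "p \<le> q" "q < h p" "i \<ge> 1"
  shows "q < (h [^]\<^bsub>comp_group \<Gamma>\<^esub> (i::nat)) p"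
  using assms(4)
proof (induction i rule: dec_induct)
  case base
  show ?case using assms by simp
next
  case (step i)
  have "p < h p" using assms by simp
  then have "(h [^]\<^bsub>comp_group \<Gamma>\<^esub> i) p < (h [^]\<^bsub>comp_group \<Gamma>\<^esub> i) (h p)"
    using map_less[of "h [^]\<^bsub>comp_group \<Gamma>\<^esub> i"] G.nat_pow_closed[of h i] assms(1) by simp
  with step.IH show ?case by simp
qed

text \<open>In this gap the conjugate of \<open>b\<close> by \<open>k\<close> fixes everything left
  of \<open>k p\<close>, hence the interval from \<open>p\<close> to \<open>q\<close> outside which
  \<open>a\<close> is the identity. The two supports are disjoint there.\<close>

lemma commutator_displaced:
  assumes cd: "c \<in> C" and pq: "q < k p" and k: "k \<in> \<Gamma>"
    and ab: "a \<in> supp_within T c p q" "b \<in> supp_within T c p q"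
    and x: "x \<in> gap C c"
  shows "a (k (b (k\<^sup>- (a\<^sup>- ((k \<circ> b \<circ> k\<^sup>-)\<^sup>- x))))) = x"
proof -
  define b' where "b' = k \<circ> b \<circ> k\<^sup>-"
  have a: "a \<in> \<Gamma>" and b: "b \<in> \<Gamma>" using ab by (auto simp: supp_within_def supp_gaps_def)
  have b': "b' \<in> \<Gamma>" unfolding b'_def using b k by (intro closed)
  define z where "z = a\<^sup>- (b'\<^sup>- x)"
  have z: "z \<in> gap C c" unfolding z_def using map_gap closed(3) a b' cd x by blast
  have "a (b' z) = b' (a z)"
  proof (rule commute_if_disjoint_supports[OF map_inj[OF a] map_inj[OF b'] _ _ _ z])
    show "a ` gap C c \<subseteq> gap C c" "b' ` gap C c \<subseteq> gap C c" using map_gap a b' cd by blast+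
  next
    fix y assume y: "y \<in> gap C c"
    show "a y = y \<or> b' y = y"
    proof (cases "y \<in> {p..q}")
      case True
      then have "y < k p" using pq by simp
      then have "k\<^sup>- y < p" using map_less[OF k, of "k\<^sup>- y" p] k by simp
      moreover have "k\<^sup>- y \<in> gap C c" using map_gap closed(3) k cd y by blast
      ultimately have "b (k\<^sup>- y) = k\<^sup>- y" using ab(2) by (auto simp: supp_within_def)
      then show ?thesis using k by (simp add: b'_def)
    next
      case False
      then show ?thesis using ab(1) y by (auto simp: supp_within_def)
    qed
  qed
  moreover have "b' (a z) = x" using a b' by (simp add: z_def)
  ultimately show ?thesis by (simp add: b'_def z_def)
qed

text \<open>Induction on the gaps. A gap fixed pointwise adds nothing. Otherwise a map that
  displaces the supports in the new gap makes the commutators trivial there, so they fall into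
  \<open>supp_gaps T\<close>, as \<open>scl_zero_displacement\<close> requires.\<close>

lemma scl_zero_derived_supp_gaps:
  assumes "finite T" "T \<subseteq> C" "w \<in> derived (comp_group \<Gamma>) (supp_gaps T)"
  shows "G.scl_zero w"
  using assms
proof (induction arbitrary: w rule: finite_induct)
  case empty
  have "derived (comp_group \<Gamma>) {id} \<subseteq> {id}"
    using G.derived_incl[OF subset_refl G.triv_subgroup] by simp
  then show ?case using empty G.scl_zero_one by (auto simp: supp_gaps_empty)
next
  case (insert c T)
  let ?R = "supp_gaps (insert c T)"
  have c: "c \<in> C" using insert.prems by blast
  have R: "?R \<subseteq> carrier (comp_group \<Gamma>)" by (rule subgroup.subset[OF supp_gaps_subgroup])
  have IH: "\<And>w. w \<in> derived (comp_group \<Gamma>) (supp_gaps T) \<Longrightarrow> G.scl_zero w"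
    using insert by blast
  consider (triv) "\<forall>x\<in>gap C c. \<forall>g\<in>\<Gamma>. g x = x"
    | (move) d where "d \<in> C" "c < d" "gap C c = {c<..<d}" "\<forall>x\<in>gap C c. \<exists>g\<in>\<Gamma>. g x \<noteq> x"
    using gap_cases[OF c] by blast
  then show ?case
  proof cases
    case triv
    have "?R \<subseteq> supp_gaps T"
    proof
      fix g assume g: "g \<in> ?R"
      then have "g \<in> \<Gamma>" by (simp add: supp_gaps_def)
      then show "g \<in> supp_gaps T" using supp_gaps_insertD[OF g] triv by blast
    qed
    then show ?thesis using IH insert.prems(2) G.mono_derived[of ?R "supp_gaps T"] by blast
  next
    case move
    show ?thesis
    proof (rule G.scl_zero_displacement[OF supp_gaps_normal IH R _ insert.prems(2)])
      fix x m assume x: "x \<in> cprod (comp_group \<Gamma>) ?R m"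
      obtain p q where pq: "c < p" "p \<le> q" "q < d"
        and xK: "x \<in> cprod (comp_group \<Gamma>) (supp_within (insert c T) c p q) m"
        using cprod_supp_within_exists[OF c move(1-3) x] by blast
      let ?K = "supp_within (insert c T) c p q"
      obtain h where h: "h \<in> \<Gamma>" "q < h p"
        using exists_map_beyond[OF c move(1) _ pq(1,3)] move(3,4) by auto
      have "a \<otimes>\<^bsub>comp_group \<Gamma>\<^esub> b' \<otimes>\<^bsub>comp_group \<Gamma>\<^esub> a\<^sup>- \<otimes>\<^bsub>comp_group \<Gamma>\<^esub> b'\<^sup>- \<in> supp_gaps T"
        if ab: "a \<in> ?K" "b \<in> ?K" and i: "i \<ge> 1"
          and b': "b' = h [^]\<^bsub>comp_group \<Gamma>\<^esub> i \<otimes>\<^bsub>comp_group \<Gamma>\<^esub> b \<otimes>\<^bsub>comp_group \<Gamma>\<^esub> (h [^]\<^bsub>comp_group \<Gamma>\<^esub> i)\<^sup>-"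
        for a b b' and i :: nat
      proof (rule supp_gaps_insertD)
        let ?k = "h [^]\<^bsub>comp_group \<Gamma>\<^esub> i"
        have k: "?k \<in> \<Gamma>" using G.nat_pow_closed[of h i] h by simp
        have "a \<in> ?R" "b \<in> ?R" using ab by (auto simp: supp_within_def)
        moreover from this have "b' \<in> ?R"
          unfolding b' using k by (intro normal.inv_op_closed2[OF supp_gaps_normal]) auto
        ultimately show "a \<otimes>\<^bsub>comp_group \<Gamma>\<^esub> b' \<otimes>\<^bsub>comp_group \<Gamma>\<^esub> a\<^sup>- \<otimes>\<^bsub>comp_group \<Gamma>\<^esub> b'\<^sup>- \<in> ?R"
          by (intro subgroup.m_closed[OF supp_gaps_subgroup] subgroup.m_inv_closed[OF supp_gaps_subgroup])
        fix x assume x: "x \<in> gap C c"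
        show "(a \<otimes>\<^bsub>comp_group \<Gamma>\<^esub> b' \<otimes>\<^bsub>comp_group \<Gamma>\<^esub> a\<^sup>- \<otimes>\<^bsub>comp_group \<Gamma>\<^esub> b'\<^sup>-) x = x"
          using commutator_displaced[OF c map_pow_beyond[OF h(1) pq(2) h(2) i] k ab x]
          by (simp add: b')
      qed
      then show "\<exists>K h. subgroup K (comp_group \<Gamma>) \<and> x \<in> cprod (comp_group \<Gamma>) K m \<and> h \<in> carrier (comp_group \<Gamma>) \<and>
         (\<forall>a\<in>K. \<forall>b\<in>K. \<forall>i\<ge>1. let b' = h [^]\<^bsub>comp_group \<Gamma>\<^esub> (i::nat) \<otimes>\<^bsub>comp_group \<Gamma>\<^esub> b \<otimes>\<^bsub>comp_group \<Gamma>\<^esub> (h [^]\<^bsub>comp_group \<Gamma>\<^esub> i)\<^sup>-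
            in a \<otimes>\<^bsub>comp_group \<Gamma>\<^esub> b' \<otimes>\<^bsub>comp_group \<Gamma>\<^esub> a\<^sup>- \<otimes>\<^bsub>comp_group \<Gamma>\<^esub> b'\<^sup>- \<in> supp_gaps T)"
        using supp_within_subgroup xK h(1)
        by (intro exI[of _ ?K] exI[of _ h] conjI ballI allI impI) (simp_all only: Let_def comp_group_simps)
    qed
  qed
qed

text \<open>Near a point of \<open>C\<close> the germs of \<open>a\<close> and \<open>b\<close>
  commute, which is transported along the inverse maps; the condition on gaps outside
  \<open>C\<close> is vacuous.\<close>

lemma commutator_in_supp_gaps:
  assumes "a \<in> \<Gamma>" "b \<in> \<Gamma>"
  shows "a \<circ> b \<circ> a\<^sup>- \<circ> b\<^sup>- \<in> supp_gaps C"
proof -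
  have "\<forall>\<^sub>F x in nhds c. a (b (a\<^sup>- (b\<^sup>- x))) = x" if c: "c \<in> C" for c
  proof -
    have "filterlim (\<lambda>x. a\<^sup>- (b\<^sup>- x)) (nhds c) (nhds c)"
      using filterlim_compose[OF filterlim_nhds filterlim_nhds] c closed(3) assms by blast
    from eventually_compose_filterlim[OF commute_near[OF assms c] this]
    show ?thesis by eventually_elim (simp add: assms)
  qed
  then show ?thesis using assms by (auto simp: supp_gaps_def closed)
qed

text \<open>Since all commutators have compact support in the gaps, intersecting the set of
  commutators with \<open>supp_gaps C\<close> loses nothing.\<close>

lemma scl_zero_derived:
  assumes "w \<in> derived (comp_group \<Gamma>) \<Gamma>" shows "G.scl_zero w"
proof (rule G.scl_zero_commutators_in[OF supp_gaps_normal])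
  show "\<And>w. w \<in> derived (comp_group \<Gamma>) (supp_gaps C) \<Longrightarrow> G.scl_zero w"
    using scl_zero_derived_supp_gaps[OF finite_C] by blast
  have "derived_set (comp_group \<Gamma>) \<Gamma> \<subseteq> supp_gaps C"
  proof
    fix x assume "x \<in> derived_set (comp_group \<Gamma>) \<Gamma>"
    then show "x \<in> supp_gaps C" using commutator_in_supp_gaps by auto
  qed
  then have "derived_set (comp_group \<Gamma>) (carrier (comp_group \<Gamma>)) \<inter> supp_gaps C = derived_set (comp_group \<Gamma>) \<Gamma>"
    by (simp add: Int_absorb2)
  then show "w \<in> generate (comp_group \<Gamma>) (derived_set (comp_group \<Gamma>) (carrier (comp_group \<Gamma>)) \<inter> supp_gaps C)"
    using assms unfolding derived_def by simp
qed

end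

section \<open>From piecewise linear groups to the abstract setting\<close>

lemma gap_eq_Ioo_or_Ioi:
  assumes "finite C" "c \<in> C"
  shows "(\<exists>d\<in>C. c < d \<and> gap C c = {c<..<d}) \<or> (gap C c = {c<..} \<and> (\<forall>d\<in>C. d \<le> c))"
proof (cases "\<exists>d\<in>C. c < d")
  case True
  define d where "d = Min {d \<in> C. c < d}"
  have fin: "finite {d \<in> C. c < d}" and ne: "{d \<in> C. c < d} \<noteq> {}" using assms True by auto
  have d: "d \<in> C" "c < d" using Min_in[OF fin ne] by (auto simp: d_def)
  have "d \<le> e" if "e \<in> C" "c < e" for e using Min_le[OF fin, of e] that by (simp add: d_def)
  then have "gap C c = {c<..<d}" using d by (force simp: gap_def)
  then show ?thesis using d by blast
next
  case False
  then show ?thesis by (auto simp: gap_def not_less)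
qed

lemma subgroup_PL_group:
  assumes "is_subgroup_PL G"
  shows "group (comp_group G)" "\<And>f. f \<in> G \<Longrightarrow> m_inv (comp_group G) f = inv_into UNIV f"
proof -
  have bij: "bij f" if "f \<in> G" for f
    using that assms PLplus_increasing[of f] strict_mono_imp_inj_on[of f]
    by (auto simp: is_subgroup_PL_def bij_def)
  have inv: "inv_into UNIV f \<in> G" "inv_into UNIV f \<circ> f = id" if "f \<in> G" for f
    using that assms bij[OF that] by (auto simp: is_subgroup_PL_def bij_is_inj)
  show grp: "group (comp_group G)"
    by (rule groupI) (use assms inv in \<open>auto simp: is_subgroup_PL_def o_assoc\<close>)
  show "m_inv (comp_group G) f = inv_into UNIV f" if "f \<in> G" for f
    using group.inv_equality[OF grp, of "inv_into UNIV f" f] inv[OF that] that by simp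
qed

lemma foldr_comp_in_cprod:
  assumes "\<And>i. i < n \<Longrightarrow> F i \<in> derived_set (comp_group G) H"
  shows "foldr (\<circ>) (map F [0..<n]) id \<in> cprod (comp_group G) H n"
  using assms
proof (induction n arbitrary: F)
  case (Suc n)
  have "map F [0..<Suc n] = F 0 # map (\<lambda>i. F (Suc i)) [0..<n]"
    by (simp add: upt_conv_Cons map_Suc_upt[symmetric] del: upt_Suc)
  moreover have "F 0 \<otimes>\<^bsub>comp_group G\<^esub> foldr (\<circ>) (map (\<lambda>i. F (Suc i)) [0..<n]) id \<in> cprod (comp_group G) H (Suc n)"
    by (intro pprod_SucI Suc.IH Suc.prems) simp_all
  moreover have "foldr (\<circ>) (f # fs) id = f \<circ> foldr (\<circ>) fs id" for f :: "'a \<Rightarrow> 'a" and fs by simp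
  ultimately show ?case by (simp only: comp_group_simps(2))
qed simp

lemma cprod_imp_prod_comms:
  assumes G: "is_subgroup_PL G" and x: "x \<in> cprod (comp_group G) G n"
  shows "prod_comms G n x"
  using x
proof (induction n arbitrary: x)
  case 0
  then show ?case by (auto simp: prod_comms_def)
next
  case (Suc n)
  then obtain s z where sz: "s \<in> derived_set (comp_group G) G" "z \<in> cprod (comp_group G) G n" "x = s \<circ> z"
    unfolding pprod.simps comp_group_simps by blast
  obtain a b where ab: "a \<in> G" "b \<in> G" "s = comm a b"
    using sz(1) by (auto simp: comm_def subgroup_PL_group(2)[OF G])
  obtain as bs where as: "\<And>i. i < n \<Longrightarrow> as i \<in> G \<and> bs i \<in> G"
    "z = foldr (\<circ>) (map (\<lambda>i. comm (as i) (bs i)) [0..<n]) id"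
    using Suc.IH[OF sz(2)] unfolding prod_comms_def by blast
  \<comment> \<open>\<open>case_nat\<close> prepends the new pair and shifts the given sequences by
    one.\<close>
  let ?as = "case_nat a as" and ?bs = "case_nat b bs"
  let ?F = "\<lambda>i. comm (?as i) (?bs i)"
  have "map ?F [0..<Suc n] = ?F 0 # map (\<lambda>i. ?F (Suc i)) [0..<n]"
    by (simp add: upt_conv_Cons map_Suc_upt[symmetric] del: upt_Suc)
  then have "x = foldr (\<circ>) (map ?F [0..<Suc n]) id" using sz(3) ab(3) as(2) by simp
  moreover have "?as i \<in> G \<and> ?bs i \<in> G" if "i < Suc n" for i
    using that as(1) ab by (cases i) auto
  ultimately show ?case unfolding prod_comms_def by blast
qed

text \<open>Finite generation makes the common fixed point set \<open>F\<close> a finite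
  intersection, so its frontier is finite. A gap avoids the frontier and is connected, hence lies in
  \<open>F\<close> or misses it.\<close>

lemma finitely_generated_PL_gap_group:
  assumes G: "is_subgroup_PL G" and S: "finite S" "S \<subseteq> G"
  defines "\<Gamma> \<equiv> generate (comp_group G) S"
  shows "\<exists>C. gap_group \<Gamma> C"
proof -
  interpret G: group "comp_group G" by (rule subgroup_PL_group(1)[OF G])
  have sub: "subgroup \<Gamma> (comp_group G)" unfolding \<Gamma>_def using S(2) by (intro G.generate_is_subgroup) simp
  have PL: "g \<in> PLplus" if "g \<in> \<Gamma>" for g
    using that subgroup.subset[OF sub] G by (auto simp: is_subgroup_PL_def)
  define F where "F = (\<Inter>s\<in>S. {x. s x = x})"
  have fixF: "g x = x" if "g \<in> \<Gamma>" "x \<in> F" for g x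
    using that(1) unfolding \<Gamma>_def
  proof induction
    case one
    show ?case by simp
  next
    case (incl h)
    then show ?case using that(2) by (auto simp: F_def)
  next
    case (inv h)
    then have "h x = x" "h \<in> G" "inj h"
      using that(2) S(2) G PLplus_increasing(1)[of h] strict_mono_imp_inj_on[of h]
      by (auto simp: F_def is_subgroup_PL_def)
    then show ?case using subgroup_PL_group(2)[OF G] by (metis inv_f_f)
  next
    case (eng h1 h2)
    then show ?case by simp
  qed
  have "closed F \<and> finite (frontier F)"
    unfolding F_def using S
  proof (induction rule: finite_induct)
    case (insert s T)
    have s: "s \<in> PLplus" using insert G by (auto simp: is_subgroup_PL_def)
    have "closed {x. s x = x}"
      using strict_mono_surj_continuous[OF PLplus_increasing[OF s]]
      by (intro closed_Collect_eq continuous_at_imp_continuous_on continuous_on_id) auto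
    moreover have "finite (frontier ({x. s x = x} \<inter> (\<Inter>s\<in>T. {x. s x = x})))"
      using insert finite_frontier_fixpoints[OF s]
      by (intro finite_subset[OF frontier_Int_subset]) auto
    ultimately show ?case using insert by auto
  qed simp
  then have F: "closed F" "finite (frontier F)" by auto
  \<comment> \<open>The frontier can be empty. Adding 0 and 1 ensures that the parts of the line
    before the first and after the last point of \<open>C\<close> are fixed pointwise.\<close>
  define C where "C = frontier F \<union> {0, 1}"
  have outF: "x \<in> F" if "x \<le> 0 \<or> 1 \<le> x" for x
    using that S(2) G PLplus_fixes_outside by (auto simp: F_def is_subgroup_PL_def)
  have CF: "C \<subseteq> F" using F(1) outF by (auto simp: C_def frontier_def)
  have finC: "finite C" using F(2) by (simp add: C_def)
  have C01: "0 \<in> C" "1 \<in> C" by (auto simp: C_def)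
  have "gap_group \<Gamma> C"
  proof (rule gap_group.intro)
    have "comp_group \<Gamma> = comp_group G\<lparr>carrier := \<Gamma>\<rparr>" by (simp add: comp_group_def)
    then show "group (comp_group \<Gamma>)" using G.subgroup_imp_group[OF sub] by simp
  next
    fix c assume c: "c \<in> C"
    show "(\<forall>x\<in>gap C c. \<forall>g\<in>\<Gamma>. g x = x) \<or>
       (\<exists>d\<in>C. c < d \<and> gap C c = {c<..<d} \<and> (\<forall>x\<in>gap C c. \<exists>g\<in>\<Gamma>. g x \<noteq> x))"
    proof (cases "gap C c \<subseteq> F")
      case True
      then show ?thesis using fixF by blast
    next
      case False
      have "\<not> (gap C c = {c<..} \<and> (\<forall>d\<in>C. d \<le> c))"
      proof
        assume "gap C c = {c<..} \<and> (\<forall>d\<in>C. d \<le> c)"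
        then have "1 \<le> x" if "x \<in> gap C c" for x using C01(2) that by fastforce
        then show False using False outF by blast
      qed
      then obtain d where d: "d \<in> C" "c < d" "gap C c = {c<..<d}"
        using gap_eq_Ioo_or_Ioi[OF finC c] by blast
      have "gap C c \<inter> frontier F = {}" by (auto simp: gap_def C_def)
      moreover have "connected (gap C c)" unfolding d(3) by (rule connected_Ioo)
      ultimately have "gap C c \<inter> F = {}" using connected_Int_frontier[of "gap C c" F] False by blast
      moreover have "\<exists>g\<in>\<Gamma>. g x \<noteq> x" if x: "x \<notin> F" for x
      proof -
        obtain s where "s \<in> S" "s x \<noteq> x" using x unfolding F_def by blast
        then show ?thesis unfolding \<Gamma>_def using generate.incl by metis
      qed
      ultimately show ?thesis using d by blast
    qed
  next
    fix g x assume "g \<in> \<Gamma>" "\<And>c. c \<in> C \<Longrightarrow> x < c"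
    then show "g x = x" using C01(1) fixF outF[of x] by force
  qed (use PLplus_increasing PL finC fixF CF PLplus_commute_near_fixpoint in \<open>auto simp: subset_iff\<close>)
  then show ?thesis by blast
qed

lemma is_subgroup_PL_generate:
  assumes G: "is_subgroup_PL G" and S: "S \<subseteq> G"
  shows "is_subgroup_PL (generate (comp_group G) S)"
proof -
  interpret G: group "comp_group G" by (rule subgroup_PL_group(1)[OF G])
  have sub: "subgroup (generate (comp_group G) S) (comp_group G)" using S by (intro G.generate_is_subgroup) simp
  show ?thesis
    using subgroup.subset[OF sub] subgroup.one_closed[OF sub] subgroup.m_closed[OF sub]
      subgroup.m_inv_closed[OF sub] subgroup_PL_group(2)[OF G] G
    by (auto simp: is_subgroup_PL_def subset_iff)
qed

lemma prod_comms_mono: "H \<subseteq> G \<Longrightarrow> prod_comms H n g \<Longrightarrow> prod_comms G n g"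
  unfolding prod_comms_def by blast

theorem theoremA:
  assumes "is_subgroup_PL G"
    and "g \<in> commutator_subgroup G"
  shows "scl G g = 0"
proof -
  obtain n as bs where as: "\<And>i. i < n \<Longrightarrow> as i \<in> G \<and> bs i \<in> G"
    and g: "g = foldr (\<circ>) (map (\<lambda>i. comm (as i) (bs i)) [0..<n]) id"
    using assms(2) unfolding commutator_subgroup_def prod_comms_def by blast
  \<comment> \<open>Only finitely many elements occur in one expression of \<open>g\<close>.
    Commutator lengths in the subgroup they generate bound those in \<open>G\<close> from above, so
    vanishing there suffices.\<close>
  define S where "S = as ` {..<n} \<union> bs ` {..<n}"
  define \<Gamma> where "\<Gamma> = generate (comp_group G) S"
  have S: "finite S" "S \<subseteq> G" using as by (auto simp: S_def)
  have PL: "is_subgroup_PL \<Gamma>" unfolding \<Gamma>_def by (rule is_subgroup_PL_generate[OF assms(1) S(2)])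
  have sub: "\<Gamma> \<subseteq> G"
    unfolding \<Gamma>_def using group.generate_incl[OF subgroup_PL_group(1)[OF assms(1)]] S(2) by simp
  obtain C where "gap_group \<Gamma> C"
    using finitely_generated_PL_gap_group[OF assms(1) S] unfolding \<Gamma>_def by blast
  then interpret gap_group \<Gamma> C .
  have "comm (as i) (bs i) \<in> derived_set (comp_group \<Gamma>) \<Gamma>" if "i < n" for i
  proof -
    have "as i \<in> \<Gamma>" "bs i \<in> \<Gamma>" using that by (auto simp: \<Gamma>_def S_def intro: generate.incl)
    then show ?thesis using subgroup_PL_group(2)[OF PL] by (auto simp: comm_def)
  qed
  then have "g \<in> cprod (comp_group \<Gamma>) \<Gamma> n" unfolding g by (rule foldr_comp_in_cprod)
  then have "g \<in> derived (comp_group \<Gamma>) \<Gamma>" using G.derived_eq_cprod[of \<Gamma>] by auto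
  then have zero: "G.scl_zero g" by (rule scl_zero_derived)
  have pow: "g [^]\<^bsub>comp_group \<Gamma>\<^esub> k = g ^^ k" for k :: nat
    by (induction k) (simp_all add: funpow_swap1 fun_eq_iff)
  have bound: "\<exists>K. \<forall>k. real (comm_length G (g ^^ k)) \<le> \<epsilon> * real k + K" if \<epsilon>: "\<epsilon> > 0" for \<epsilon> :: real
  proof -
    have "G.cl_rate_le g \<epsilon>" using zero \<epsilon> unfolding G.scl_zero_def by blast
    then obtain K where "\<forall>k::nat. \<exists>n. g ^^ k \<in> cprod (comp_group \<Gamma>) \<Gamma> n \<and> real n \<le> \<epsilon> * real k + K"
      unfolding G.cl_rate_le_def pow comp_group_simps(1) by (elim exE)
    then have K: "\<exists>n. g ^^ k \<in> cprod (comp_group \<Gamma>) \<Gamma> n \<and> real n \<le> \<epsilon> * real k + K" for k :: nat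
      by (rule spec)
    have "real (comm_length G (g ^^ k)) \<le> \<epsilon> * real k + K" for k
    proof -
      obtain m where m: "g ^^ k \<in> cprod (comp_group \<Gamma>) \<Gamma> m" "real m \<le> \<epsilon> * real k + K"
        using K[of k] by (elim exE conjE)
      have "prod_comms G m (g ^^ k)" using prod_comms_mono[OF sub cprod_imp_prod_comms[OF PL m(1)]] .
      then have "comm_length G (g ^^ k) \<le> m" unfolding comm_length_def by (rule Least_le)
      then show ?thesis using m(2) by linarith
    qed
    then show ?thesis by blast
  qed
  have "(\<lambda>k. real (comm_length G (g ^^ k)) / real k) \<longlonglongrightarrow> 0"
  proof (rule LIMSEQ_I)
    fix r :: real assume r: "0 < r"
    \<comment> \<open>Half of \<open>r\<close> is spent on the rate; the other half absorbs
      \<open>K\<close> once \<open>k > 2 * K / r\<close>. Starting at \<open>Suc N\<close> keeps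
      \<open>k\<close> positive for the division.\<close>
    obtain K where K: "\<And>k. real (comm_length G (g ^^ k)) \<le> r / 2 * real k + K"
      using bound[of "r / 2"] r by auto
    obtain N :: nat where N: "2 * K / r < real N" using reals_Archimedean2 by blast
    show "\<exists>N. \<forall>k\<ge>N. norm (real (comm_length G (g ^^ k)) / real k - 0) < r"
    proof (intro exI[of _ "Suc N"] allI impI)
      fix k assume k: "Suc N \<le> k"
      then have "2 * K / r < real k" using N by simp
      then have "K < r / 2 * real k" using r by (simp add: field_simps)
      then have "real (comm_length G (g ^^ k)) < r * real k" using K[of k] by simp
      then show "norm (real (comm_length G (g ^^ k)) / real k - 0) < r"
        using k by (simp add: field_simps)
    qed
  qed
  then have "(\<lambda>k. ereal (real (comm_length G (g ^^ k)) / real k)) \<longlonglongrightarrow> ereal 0"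
    by (simp only: lim_ereal)
  then show ?thesis
    unfolding scl_def by (simp add: lim_imp_Liminf zero_ereal_def)
qed

end
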